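(* Let $1<p<\infty$ and let $f\in L_1([-\pi,\pi])$ have Fourier series $\sum_{k=-\infty}^{\infty}a_ke^{ikx}$. If $a=\{a_k\}_{k\in\mathbb Z}\in\overline{\mathrm{GM}}$, then $$\|f\|_{L_p([-\pi,\pi])}\asymp J_p(f),$$ i.e. there are constants $0<c_1\le c_2<\infty$ depending only on $p$ and on the constant $C$ in the definition of $\overline{\mathrm{GM}}$ such that $c_1J_p(f)\le\|f\|_{L_p}\le c_2J_p(f)$ (both sides being simultaneously finite or infinite).
   Context: For a two-sided sequence $a=\{a_k\}_{k\in\mathbb Z}$ of complex numbers put $|\Delta a_k|=|a_k-a_{k+1}|$ for $k>0$, $|\Delta a_k|=|a_k-a_{k-1}|$ for $k<0$, and $|\Delta a_0|=|a_0-a_1|+|a_0-a_{-1}|$. For $k\ge0$ put $$\widehat a_{2^k}=\sup_{2^k\le|m|<2^{k+1}}\frac1{|m|+1}\Big|\sum_{j=0}^{m}a_j\Big|,$$ where for $m<0$ the sum $\sum_{j=0}^m a_j$ means $\sum_{j=m}^{0}a_j$. $[x]$ denotes the floor function. The sequence $a$ belongs to $\overline{\mathrm{GM}}$ if there is $C>0$ such that for every $n\ge0$, $$\sum_{[2^{n-1}]\le|m|<2^n}|\Delta a_m|\le C\sup_{k\in\mathbb N_0}\min(1,2^{k-n})\,\widehat a_{2^k}.$$ The Fourier coefficients are $a_k=\frac1{2\pi}\int_{-\pi}^{\pi}f(x)e^{-ikx}dx$, and $J_p(f)=\big(\sum_{k\in\mathbb Z}(|k|+1)^{p-2}|a_k|^p\big)^{1/p}$.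 *)

theory Defs
  imports "HOL-Analysis.Analysis"
begin

definition fourier_coeff :: "(real \<Rightarrow> complex) \<Rightarrow> int \<Rightarrow> complex" where
  "fourier_coeff f k = complex_of_real (1 / (2 * pi)) *
     (LINT x:{-pi..pi}|lborel. f x * exp (- (\<i> * of_int k * complex_of_real x)))"

definition Delta_abs :: "(int \<Rightarrow> complex) \<Rightarrow> int \<Rightarrow> real" where
  "Delta_abs a k =
     (if k > 0 then norm (a k - a (k + 1))
      else if k < 0 then norm (a k - a (k - 1))
      else norm (a 0 - a 1) + norm (a 0 - a (-1)))"

definition psum :: "(int \<Rightarrow> complex) \<Rightarrow> int \<Rightarrow> complex" where
  "psum a m = (if m \<ge> 0 then (\<Sum>j\<in>{0..m}. a j) else (\<Sum>j\<in>{m..0}. a j))"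

definition hat_a :: "(int \<Rightarrow> complex) \<Rightarrow> nat \<Rightarrow> real" where
  "hat_a a k = Sup ((\<lambda>m. norm (psum a m) / (of_int \<bar>m\<bar> + 1)) `
                     {m::int. 2 ^ k \<le> \<bar>m\<bar> \<and> \<bar>m\<bar> < 2 ^ (k + 1)})"

text \<open>Membership in GM-bar with constant C. floor(2^(n-1)) = 2^n div 2 for n >= 0.
  The supremum on the right may be infinite, so it is taken in ennreal.\<close>
definition GM_bar_with :: "real \<Rightarrow> (int \<Rightarrow> complex) \<Rightarrow> bool" where
  "GM_bar_with C a \<longleftrightarrow> C > 0 \<and>
     (\<forall>n::nat. ennreal (\<Sum>m\<in>{m::int. 2 ^ n div 2 \<le> \<bar>m\<bar> \<and> \<bar>m\<bar> < 2 ^ n}. Delta_abs a m)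
        \<le> ennreal C * (SUP k::nat. ennreal (min 1 (2 powr (real k - real n)) * hat_a a k)))"

definition GM_bar :: "(int \<Rightarrow> complex) \<Rightarrow> bool" where
  "GM_bar a \<longleftrightarrow> (\<exists>C. GM_bar_with C a)"

definition Jp_pow :: "real \<Rightarrow> (real \<Rightarrow> complex) \<Rightarrow> ennreal" where
  "Jp_pow p f = (\<Sum>\<^sub>\<infinity>k::int. ennreal ((of_int \<bar>k\<bar> + 1) powr (p - 2) * norm (fourier_coeff f k) powr p))"

definition Lp_norm_pow :: "real \<Rightarrow> (real \<Rightarrow> complex) \<Rightarrow> ennreal" where
  "Lp_norm_pow p f = (\<integral>\<^sup>+ x. indicator {-pi..pi} x * ennreal (norm (f x) powr p) \<partial>lborel)"

end

theory Submission
  imports Defs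
begin

text \<open>Everything is measured dyadically. Let \<open>A k = hat_a a k\<close> and let \<open>G n\<close> be the supremum on the
  right-hand side of the \<open>GM\<close> condition. The variation of \<open>a\<close> over the n-th dyadic block is \<open>O(G n)\<close>, and
  comparison with block averages shows that so are its terms. The Dirichlet kernel is
  \<open>O(min m (1 / \<bar>x\<bar>))\<close>, so \<open>A\<close> is dominated by the masses of \<open>\<bar>f\<bar>\<close> on the dyadic shells
  \<open>\<bar>x\<bar> \<sim> 2 powr (- j)\<close>; trivially it is also dominated by the block means of \<open>\<bar>a\<bar>\<close>. Conversely, Abel summation
  bounds the partial sums of the Fourier series on the j-th shell by \<open>2 ^ j\<close> times an average of \<open>G\<close>,
  and by dominated convergence and uniqueness of Fourier coefficients these bounds pass to \<open>f\<close>.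
  All the averages involved have the kernel \<open>min 1 (2 powr (j - n))\<close>, which is bounded on the sequence
  space \<open>\<ell>\<^sub>p\<close> with weights \<open>2 powr (n * (p - 1))\<close>, and with these weights the masses, respectively the means,
  are controlled by the \<open>L\<^sub>p\<close> norm, respectively by \<open>J\<^sub>p\<close>.\<close>

section \<open>A weighted discrete Hardy inequality\<close>

text \<open>The weight is forced by both sides. A block has about \<open>2 ^ n\<close> indices of
  weight about \<open>2 powr (n * (p - 2))\<close>; and by a Hoelder-type bound the p-th power of
  the mass on a shell of width about \<open>2 powr (- j)\<close> is at most a constant times
  \<open>2 powr (- j * (p - 1))\<close> times the integral of the p-th power of \<bar>f\<bar>.
  Against the weight the kernel decays away from the diagonal at the rates
  \<open>(p - 1) / p\<close> and \<open>1 / p\<close> on its two sides, and both are positive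
  exactly because \<open>1 < p < \<infinity>\<close>. Two finiteness questions shape the rest.
  Coefficients of an integrable function are bounded, so each supremum \<open>G n\<close> is a real
  number. Convergence of the Fourier series is not given; it is drawn from
  \<open>J\<^sub>p < \<infinity>\<close>, which makes \<open>G\<close> summable, while for infinite
  \<open>J\<^sub>p\<close> the upper bound of the norm is trivial. The limit is at first only some
  function with an integrable majorant, which is why uniqueness is needed to identify it with
  \<open>f\<close>. The constants depend on \<open>p\<close> and \<open>C\<close> alone because the
  Hardy inequality fixes its constant before the sequences are chosen.\<close>

definition kap :: "nat \<Rightarrow> nat \<Rightarrow> real" where
  "kap n j = min 1 (2 powr (real j - real n))"

definition wsum :: "real \<Rightarrow> (nat \<Rightarrow> real) \<Rightarrow> ennreal" where
  "wsum p u = (\<Sum>n. ennreal (2 powr (real n * (p - 1)) * u n powr p))"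

lemma kap_nonneg: "0 \<le> kap n j"
  by (simp add: kap_def)

lemma kap_le_1: "kap n j \<le> 1"
  by (simp add: kap_def)

lemma ennreal_le_suminf: "f n \<le> (\<Sum>n. f n :: ennreal)"
  using sum_le_suminf[OF summableI finite.insertI[OF finite.emptyI], of n f] by simp

text \<open>On either side of \<open>j\<close> the terms form a geometric series. The two index
  ranges used overlap in \<open>j\<close>, which does no harm in an upper bound.\<close>

lemma suminf_geometric_dist_le:
  fixes q :: real
  assumes "0 < q" "q < 1"
  shows "(\<Sum>n. ennreal (q powr \<bar>real n - real j\<bar>)) \<le> ennreal (2 / (1 - q))"
proof (rule suminf_le_const[OF summableI])
  fix N
  have geo: "(\<Sum>i<k. q ^ i) \<le> 1 / (1 - q)" for k
    using sum_le_suminf[of "\<lambda>i. q ^ i" "{..<k}"] assms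
    by (simp add: suminf_geometric summable_geometric)
  have pw: "q powr (real a - real b) = q ^ (a - b)" if "b \<le> a" for a b
    using assms powr_realpow[of q "a - b"] that by (simp add: of_nat_diff)
  have "(\<Sum>n<N. q powr \<bar>real n - real j\<bar>) \<le> (\<Sum>n\<in>{..<Suc j} \<union> {j..<j+N}. q powr \<bar>real n - real j\<bar>)"
    by (rule sum_mono2) (auto intro: less_le_trans)
  also have "\<dots> \<le> (\<Sum>n<Suc j. q powr \<bar>real n - real j\<bar>) + (\<Sum>n\<in>{j..<j+N}. q powr \<bar>real n - real j\<bar>)"
    by (subst sum_Un) (auto intro!: sum_nonneg)
  also have "(\<Sum>n<Suc j. q powr \<bar>real n - real j\<bar>) = (\<Sum>i<Suc j. q ^ i)"
    by (rule sum.reindex_bij_witness[of _ "\<lambda>i. j - i" "\<lambda>i. j - i"]) (auto simp: pw)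
  also have "(\<Sum>n\<in>{j..<j+N}. q powr \<bar>real n - real j\<bar>) = (\<Sum>i<N. q ^ i)"
    by (rule sum.reindex_bij_witness[of _ "\<lambda>i. i + j" "\<lambda>i. i - j"]) (auto simp: pw)
  also have "(\<Sum>i<Suc j. q ^ i) + (\<Sum>i<N. q ^ i) \<le> 2 / (1 - q)"
    using geo[of "Suc j"] geo[of N] by simp
  finally show "(\<Sum>n<N. ennreal (q powr \<bar>real n - real j\<bar>)) \<le> ennreal (2 / (1 - q))"
    by (subst sum_ennreal) (auto intro: ennreal_leI)
qed

text \<open>After the substitution \<open>U n = 2 powr (n * (p - 1) / p) * u n\<close> the kernel decays like
  \<open>r powr (2 * \<bar>n - j\<bar>)\<close>; one factor \<open>r powr \<bar>n - j\<bar>\<close> makes the kernel summable, the other one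
  is kept inside a supremum, which the p-th power commutes with.\<close>

lemma hardy_kap:
  assumes "1 < p" "0 < K"
  shows "\<exists>M>0. \<forall>u v. (\<forall>n. 0 \<le> u n) \<longrightarrow> (\<forall>n. 0 \<le> v n) \<longrightarrow>
       (\<forall>n. ennreal (v n) \<le> ennreal K * (\<Sum>j. ennreal (kap n j * u j))) \<longrightarrow>
       wsum p v \<le> ennreal M * wsum p u"
proof -
  \<comment> \<open>\<open>s\<close> and \<open>1 - s = 1 / p\<close> are the decay rates of the
    weighted kernel for \<open>n \<le> j\<close> and for \<open>n > j\<close>. Since
    \<open>2 * e\<close> is below both, the decay can be split into two equal factors of rate
    \<open>e\<close>.\<close>
  define e where "e = min ((p - 1) / p) (1 / p) / 2"
  define r :: real where "r = 2 powr (- e)"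
  define q :: real where "q = r powr p"
  define s where "s = (p - 1) / p"
  define M1 where "M1 = 2 / (1 - r)"
  define M2 where "M2 = 2 / (1 - q)"
  have e: "0 < e" "2 * e \<le> s" "2 * e \<le> 1 / p"
    using assms by (auto simp: e_def s_def)
  have r: "0 < r" "r < 1"
    using e powr_less_mono[of "- e" 0 2] by (auto simp: r_def)
  have q: "0 < q" "q < 1"
    using r assms powr_less_mono2[of p r 1] by (auto simp: q_def)
  have s1: "1 - s = 1 / p"
    using assms by (simp add: s_def field_simps)
  have M: "0 < M1" "0 < M2"
    using r q by (auto simp: M1_def M2_def)
  have kap_le: "2 powr (real n * s) * kap n j \<le> (r powr \<bar>real n - real j\<bar>) * (r powr \<bar>real n - real j\<bar>) * 2 powr (real j * s)" for n j
  proof -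
    have rr: "(r powr \<bar>real n - real j\<bar>) * (r powr \<bar>real n - real j\<bar>) = 2 powr (- 2 * e * \<bar>real n - real j\<bar>)"
      by (simp add: r_def powr_powr powr_add[symmetric] mult.assoc)
    show ?thesis
    proof (cases "n \<le> j")
      case True
      have "(real j - real n) * (2 * e) \<le> (real j - real n) * s"
        using e True by (intro mult_left_mono) auto
      hence "real n * s \<le> - 2 * e * \<bar>real n - real j\<bar> + real j * s"
        using True by (simp add: algebra_simps)
      hence "2 powr (real n * s) \<le> 2 powr (- 2 * e * \<bar>real n - real j\<bar> + real j * s)"
        by (intro powr_mono) auto
      moreover have "2 powr (real n * s) * kap n j \<le> 2 powr (real n * s) * 1"
        by (intro mult_left_mono kap_le_1) auto
      ultimately show ?thesis
        unfolding rr powr_add by linarith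
    next
      case False
      have "(real n - real j) * (2 * e) \<le> (real n - real j) * (1 - s)"
        using e False s1 by (intro mult_left_mono) auto
      hence "real n * s + (real j - real n) \<le> - 2 * e * \<bar>real n - real j\<bar> + real j * s"
        using False by (simp add: algebra_simps)
      hence "2 powr (real n * s + (real j - real n)) \<le> 2 powr (- 2 * e * \<bar>real n - real j\<bar> + real j * s)"
        by (intro powr_mono) auto
      moreover have "2 powr (real n * s) * kap n j \<le> 2 powr (real n * s) * 2 powr (real j - real n)"
        by (intro mult_left_mono) (auto simp: kap_def)
      ultimately show ?thesis
        unfolding rr powr_add by linarith
    qed
  qed
  show ?thesis
  proof (intro exI[of _ "(K * M1) powr p * M2"] conjI allI impI)
    show "0 < (K * M1) powr p * M2"
      using assms M by simp
    fix u v :: "nat \<Rightarrow> real"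
    assume "\<forall>n. 0 \<le> u n" "\<forall>n. 0 \<le> v n"
      and "\<forall>n. ennreal (v n) \<le> ennreal K * (\<Sum>j. ennreal (kap n j * u j))"
    hence u: "0 \<le> u n" and v: "0 \<le> v n"
      and le: "ennreal (v n) \<le> ennreal K * (\<Sum>j. ennreal (kap n j * u j))" for n
      by auto
    define U where "U n = 2 powr (real n * s) * u n" for n
    define V where "V n = 2 powr (real n * s) * v n" for n
    have powU: "(2 powr (real n * s) * x) powr p = 2 powr (real n * (p - 1)) * x powr p" if "0 \<le> x" for n x
      using assms that by (simp add: powr_mult powr_powr s_def)
    have U: "0 \<le> U n" "0 \<le> V n" for n
      using u v by (auto simp: U_def V_def)
    have wU: "wsum p u = (\<Sum>j. ennreal (U j powr p))"
      by (simp add: wsum_def U_def powU u)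
    have wV: "wsum p v = (\<Sum>j. ennreal (V j powr p))"
      by (simp add: wsum_def V_def powU v)
    define T where "T n = (\<Sum>j. ennreal (q powr \<bar>real n - real j\<bar> * U j powr p))" for n
    show "wsum p v \<le> ennreal ((K * M1) powr p * M2) * wsum p u"
    proof (cases "wsum p u = \<infinity>")
      case True
      thus ?thesis
        using assms M by (simp add: ennreal_mult_top)
    next
      case False
      have VT: "ennreal (V n powr p) \<le> ennreal ((K * M1) powr p) * T n" for n
      proof -
        have "T n \<le> wsum p u"
          unfolding T_def wU
          using q by (intro suminf_le) (auto intro!: ennreal_leI mult_left_le_one_le simp: powr_le1)
        hence fin: "T n < \<infinity>"
          using False by (simp add: less_top order_le_less_trans)
        \<comment> \<open>\<open>c\<close> stands in for the supremum over \<open>j\<close> of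
          \<open>r powr \<bar>n - j\<bar> * U j\<close>: the p-th power of each of these numbers is
          one summand of \<open>T n\<close>, because \<open>q = r powr p\<close>.\<close>
        define c where "c = enn2real (T n) powr (1 / p)"
        have c: "0 \<le> c" "ennreal (c powr p) = T n"
          using assms fin by (auto simp: c_def powr_powr)
        have rU: "r powr \<bar>real n - real j\<bar> * U j \<le> c" for j
        proof -
          have "ennreal (q powr \<bar>real n - real j\<bar> * U j powr p) \<le> T n"
            unfolding T_def by (rule ennreal_le_suminf)
          also have "\<dots> = ennreal (c powr p)"
            using c by simp
          also have "q powr \<bar>real n - real j\<bar> * U j powr p = (r powr \<bar>real n - real j\<bar> * U j) powr p"
            using U by (simp add: q_def powr_mult powr_powr mult.commute)
          finally have "(r powr \<bar>real n - real j\<bar> * U j) powr p \<le> c powr p"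
            by simp
          thus ?thesis
            using assms U[of j] c powr_less_mono2[of p c "r powr \<bar>real n - real j\<bar> * U j"] by force
        qed
        have "ennreal (V n) = ennreal (2 powr (real n * s)) * ennreal (v n)"
          by (simp add: V_def ennreal_mult v)
        also have "\<dots> \<le> ennreal (2 powr (real n * s)) * (ennreal K * (\<Sum>j. ennreal (kap n j * u j)))"
          by (intro mult_left_mono le) auto
        also have "\<dots> = ennreal K * (\<Sum>j. ennreal (2 powr (real n * s)) * ennreal (kap n j * u j))"
          by (simp add: mult_ac)
        also have "\<dots> \<le> ennreal K * (\<Sum>j. ennreal (r powr \<bar>real n - real j\<bar>) * ennreal c)"
        proof (intro mult_left_mono suminf_le summableI)
          fix j
          have "2 powr (real n * s) * (kap n j * u j) = (2 powr (real n * s) * kap n j) * u j"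
            by simp
          also have "\<dots> \<le> ((r powr \<bar>real n - real j\<bar>) * (r powr \<bar>real n - real j\<bar>) * 2 powr (real j * s)) * u j"
            by (intro mult_right_mono kap_le u)
          also have "\<dots> = r powr \<bar>real n - real j\<bar> * (r powr \<bar>real n - real j\<bar> * U j)"
            by (simp add: U_def)
          also have "\<dots> \<le> r powr \<bar>real n - real j\<bar> * c"
            by (intro mult_left_mono rU) auto
          finally show "ennreal (2 powr (real n * s)) * ennreal (kap n j * u j) \<le> ennreal (r powr \<bar>real n - real j\<bar>) * ennreal c"
            using c by (simp add: ennreal_mult'[symmetric] ennreal_leI)
        qed auto
        also have "\<dots> = ennreal K * ((\<Sum>j. ennreal (r powr \<bar>real j - real n\<bar>)) * ennreal c)"
          by (simp add: abs_minus_commute)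
        also have "\<dots> \<le> ennreal K * (ennreal M1 * ennreal c)"
          unfolding M1_def using r by (intro mult_left_mono mult_right_mono suminf_geometric_dist_le) auto
        also have "\<dots> = ennreal (K * M1 * c)"
          using assms M c by (simp add: ennreal_mult'[symmetric] mult.assoc)
        finally have "V n \<le> K * M1 * c"
          using assms M c by simp
        hence "V n powr p \<le> (K * M1) powr p * c powr p"
          using assms M c U powr_mono2[of p "V n" "K * M1 * c"] by (simp add: powr_mult)
        hence "ennreal (V n powr p) \<le> ennreal ((K * M1) powr p * c powr p)"
          by (rule ennreal_leI)
        thus ?thesis
          using c by (simp add: ennreal_mult)
      qed
      have "wsum p v \<le> (\<Sum>n. ennreal ((K * M1) powr p) * T n)"
        unfolding wV by (intro suminf_le VT summableI)
      also have "\<dots> = ennreal ((K * M1) powr p) * (\<Sum>n. T n)"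
        by simp
      \<comment> \<open>Tonelli: the outer sum is read as an integral over the counting measure, so
        that the sum over \<open>n\<close> can be carried out first.\<close>
      also have "(\<Sum>n. T n) = (\<integral>\<^sup>+n. (\<Sum>j. ennreal (q powr \<bar>real n - real j\<bar> * U j powr p)) \<partial>count_space UNIV)"
        by (simp add: T_def nn_integral_count_space_nat)
      also have "\<dots> = (\<Sum>j. \<Sum>n. ennreal (q powr \<bar>real n - real j\<bar> * U j powr p))"
        by (subst nn_integral_suminf) (auto simp: nn_integral_count_space_nat)
      also have "\<dots> = (\<Sum>j. (\<Sum>n. ennreal (q powr \<bar>real n - real j\<bar>)) * ennreal (U j powr p))"
        by (simp add: ennreal_mult)
      also have "\<dots> \<le> (\<Sum>j. ennreal M2 * ennreal (U j powr p))"
        unfolding M2_def using q by (intro suminf_le mult_right_mono suminf_geometric_dist_le summableI) auto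
      also have "\<dots> = ennreal M2 * wsum p u"
        by (simp add: wU)
      finally show ?thesis
        using assms M by (simp add: ennreal_mult mult.assoc mult_left_mono)
    qed
  qed
qed

text \<open>Integrating \<open>g \<le> t + t powr (1 - p) * g powr p\<close> and optimising in \<open>t\<close> replaces
  Hoelder's inequality at the cost of the factor \<open>2 powr p\<close>.\<close>

lemma nn_integral_powr_ge:
  fixes g :: "'a \<Rightarrow> real"
  assumes p: "1 < p" and s: "0 < s" "emeasure M (space M) \<le> ennreal s"
    and g[measurable]: "g \<in> borel_measurable M" and nonneg: "\<And>x. 0 \<le> g x"
    and F: "0 \<le> F" "ennreal F = (\<integral>\<^sup>+x. ennreal (g x) \<partial>M)"
  shows "ennreal (F powr p) \<le> ennreal (2 powr p * s powr (p - 1)) * (\<integral>\<^sup>+x. ennreal (g x powr p) \<partial>M)"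
proof (cases "(\<integral>\<^sup>+x. ennreal (g x powr p) \<partial>M) = \<infinity>")
  case True
  thus ?thesis using s by (simp add: ennreal_mult_top)
next
  case False
  define P where "P = enn2real (\<integral>\<^sup>+x. ennreal (g x powr p) \<partial>M)"
  have P: "0 \<le> P" "ennreal P = (\<integral>\<^sup>+x. ennreal (g x powr p) \<partial>M)"
    using False by (auto simp: P_def ennreal_enn2real less_top)
  have bound: "F \<le> t * s + t powr (1 - p) * P" if t: "0 < t" for t
  proof -
    have *: "g x \<le> t + t powr (1 - p) * g x powr p" for x
    proof (cases "g x \<le> t")
      case True
      thus ?thesis by (simp add: add_increasing2)
    next
      case False
      hence "g x powr (1 - p) \<le> t powr (1 - p)"
        using t p by (intro powr_mono2') auto
      hence "g x powr (1 - p) * g x powr p \<le> t powr (1 - p) * g x powr p"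
        by (intro mult_right_mono) auto
      moreover have "g x powr (1 - p) * g x powr p = g x"
        using False t by (simp add: powr_add[symmetric])
      ultimately show ?thesis using t by linarith
    qed
    have "ennreal F \<le> (\<integral>\<^sup>+x. ennreal t + ennreal (t powr (1 - p)) * ennreal (g x powr p) \<partial>M)"
      unfolding F(2) using * t
      by (intro nn_integral_mono) (auto simp: ennreal_plus[symmetric] ennreal_mult'[symmetric] simp del: ennreal_plus intro!: ennreal_leI)
    also have "\<dots> = ennreal t * emeasure M (space M) + ennreal (t powr (1 - p)) * ennreal P"
      by (simp add: nn_integral_add nn_integral_cmult P(2))
    also have "\<dots> \<le> ennreal t * ennreal s + ennreal (t powr (1 - p)) * ennreal P"
      by (intro add_right_mono mult_left_mono s) auto
    also have "\<dots> = ennreal (t * s + t powr (1 - p) * P)"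
      using t s P(1) by (simp add: ennreal_plus[symmetric] ennreal_mult'[symmetric] del: ennreal_plus)
    finally show ?thesis
      using t s P(1) by (subst (asm) ennreal_le_iff) auto
  qed
  show ?thesis
  proof (cases "P = 0")
    case True
    \<comment> \<open>With \<open>P = 0\<close> the optimal \<open>t\<close> would be 0, which is
      not admissible; \<open>t\<close> is sent to 0 instead.\<close>
    have "F \<le> 0 + e" if "0 < e" for e
      using bound[of "e / s"] that s True by simp
    hence "F \<le> 0"
      by (rule field_le_epsilon)
    thus ?thesis using F p by simp
  next
    case False
    \<comment> \<open>This \<open>t\<close> balances the two terms of the bound:
      \<open>t powr (1 - p) * P = t * s\<close>.\<close>
    define t where "t = (P / s) powr (1 / p)"
    have t: "0 < t" "t powr p = P / s"
      using False P s p by (auto simp: t_def powr_powr)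
    have "t powr (1 - p) * P = t powr (1 - p) * t powr p * s"
      using t s by simp
    also have "\<dots> = t * s"
      unfolding powr_add[symmetric] using t by simp
    finally have "F \<le> 2 * (t * s)"
      using bound[OF t(1)] by linarith
    hence "F powr p \<le> (2 * (t * s)) powr p"
      using F p by (intro powr_mono2) auto
    also have "\<dots> = 2 powr p * ((P / s) * s powr p)"
      using t s by (simp add: powr_mult)
    also have "s powr p = s powr (p - 1) * s"
      using s by (simp add: powr_diff)
    finally have "F powr p \<le> 2 powr p * s powr (p - 1) * P"
      using s by (simp add: mult_ac)
    hence "ennreal (F powr p) \<le> ennreal (2 powr p * s powr (p - 1) * P)"
      by (rule ennreal_leI)
    thus ?thesis
      by (simp add: P(2)[symmetric] ennreal_mult''[symmetric] P(1))
  qed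
qed

section \<open>General monotone sequences\<close>

text \<open>Integer division gives \<open>block 0 = {0}\<close>, so the blocks partition the
  integers. The range of \<open>m\<close> in \<open>hat_a a k\<close> is
  \<open>block (Suc k)\<close>, one index higher.\<close>

definition block :: "nat \<Rightarrow> int set" where
  "block n = {m. 2 ^ n div 2 \<le> \<bar>m\<bar> \<and> \<bar>m\<bar> < 2 ^ n}"

text \<open>A real supremum in place of the extended one in \<open>GM_bar_with\<close>; it is
  meaningful for bounded \<open>a\<close>, as assumed in the estimates below.\<close>

definition gm_bound :: "(int \<Rightarrow> complex) \<Rightarrow> nat \<Rightarrow> real" where
  "gm_bound a n = (SUP k. kap n k * hat_a a k)"

lemma finite_block [simp]: "finite (block n)"
proof (rule finite_subset)
  show "block n \<subseteq> {- (2 ^ n)..2 ^ n}" by (auto simp: block_def)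
qed simp

lemma finite_dyadic_shell: "finite {m::int. 2 ^ k \<le> \<bar>m\<bar> \<and> \<bar>m\<bar> < 2 ^ (k + 1)}"
proof (rule finite_subset)
  show "{m::int. 2 ^ k \<le> \<bar>m\<bar> \<and> \<bar>m\<bar> < 2 ^ (k + 1)} \<subseteq> {- (2 ^ (k + 1))..2 ^ (k + 1)}" by auto
qed simp

lemma psum_le_hat_a:
  assumes "2 ^ k \<le> \<bar>m\<bar>" "\<bar>m\<bar> < 2 ^ (k + 1)"
  shows "norm (psum a m) \<le> (of_int \<bar>m\<bar> + 1) * hat_a a k"
proof -
  have "norm (psum a m) / (of_int \<bar>m\<bar> + 1) \<le> hat_a a k"
    unfolding hat_a_def using assms finite_dyadic_shell
    by (intro cSup_upper bdd_above_finite finite_imageI) auto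
  thus ?thesis by (simp add: divide_le_eq add_nonneg_pos mult.commute)
qed

lemma hat_a_leI:
  assumes "\<And>m. 2 ^ k \<le> \<bar>m\<bar> \<Longrightarrow> \<bar>m\<bar> < 2 ^ (k + 1) \<Longrightarrow> norm (psum a m) / (of_int \<bar>m\<bar> + 1) \<le> x"
  shows "hat_a a k \<le> x"
  unfolding hat_a_def
proof (rule cSup_least)
  have "2 ^ k \<in> {m::int. 2 ^ k \<le> \<bar>m\<bar> \<and> \<bar>m\<bar> < 2 ^ (k + 1)}" by simp
  thus "(\<lambda>m. norm (psum a m) / (of_int \<bar>m\<bar> + 1)) ` {m::int. 2 ^ k \<le> \<bar>m\<bar> \<and> \<bar>m\<bar> < 2 ^ (k + 1)} \<noteq> {}"
    by blast
qed (use assms in auto)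

lemma hat_a_nonneg: "0 \<le> hat_a a k"
proof -
  have "0 \<le> (of_int \<bar>2 ^ k :: int\<bar> + 1) * hat_a a k"
    by (rule order_trans[OF norm_ge_zero psum_le_hat_a]) auto
  moreover have "(0::real) < of_int \<bar>2 ^ k :: int\<bar> + 1"
    by (simp add: add_nonneg_pos)
  ultimately show ?thesis
    by (simp only: zero_le_mult_iff) linarith
qed

lemma norm_psum_le:
  assumes "\<And>k. norm (a k) \<le> B"
  shows "norm (psum a m) \<le> (of_int \<bar>m\<bar> + 1) * B"
proof -
  have "norm (\<Sum>j\<in>S. a j) \<le> of_nat (card S) * B" for S
    using sum_norm_bound[of S a B] assms by auto
  from this[of "{0..m}"] this[of "{m..0}"] show ?thesis
    by (auto simp: psum_def)
qed

lemma hat_a_le: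
  assumes "\<And>k. norm (a k) \<le> B"
  shows "hat_a a k \<le> B"
proof (rule hat_a_leI)
  fix m :: int
  show "norm (psum a m) / (of_int \<bar>m\<bar> + 1) \<le> B"
    using norm_psum_le[where a = a and m = m, OF assms] by (simp add: divide_le_eq add_nonneg_pos mult.commute)
qed

text \<open>The sign \<open>s\<close> reduces both halves of the sequence to sequences over
  \<open>nat\<close>; the index 0 belongs to both of them.\<close>

lemma psum_one_sided:
  assumes "s = 1 \<or> s = - 1"
  shows "psum a (s * int m) = (\<Sum>j\<le>m. a (s * int j))"
  using assms
proof
  assume "s = 1"
  thus ?thesis
    by (simp add: psum_def) (rule sum.reindex_bij_witness[of _ int nat]; auto)
next
  assume "s = - 1"
  thus ?thesis
    by (cases "m = 0", force simp: psum_def)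
       (simp add: psum_def, rule sum.reindex_bij_witness[of _ "\<lambda>k. - int k" "\<lambda>k. nat (- k)"]; auto)
qed

lemma kap_antimono: "n \<le> n' \<Longrightarrow> kap n' k \<le> kap n k"
  by (auto simp: kap_def min_le_iff_disj)

context
  fixes a :: "int \<Rightarrow> complex" and B :: real
  assumes bounded: "\<And>k. norm (a k) \<le> B"
begin

lemma kap_hat_a_le: "kap n k * hat_a a k \<le> B"
proof -
  have "kap n k * hat_a a k \<le> 1 * hat_a a k"
    by (intro mult_right_mono kap_le_1 hat_a_nonneg)
  thus ?thesis using hat_a_le[where a = a and k = k, OF bounded] by simp
qed

lemma bdd_above_kap_hat_a: "bdd_above (range (\<lambda>k. kap n k * hat_a a k))"
  by (rule bdd_aboveI[of _ B]) (auto intro: kap_hat_a_le)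

lemma kap_hat_a_le_gm_bound: "kap n k * hat_a a k \<le> gm_bound a n"
  unfolding gm_bound_def by (intro cSUP_upper bdd_above_kap_hat_a) auto

lemma hat_a_le_gm_bound: "n \<le> k \<Longrightarrow> hat_a a k \<le> gm_bound a n"
  using kap_hat_a_le_gm_bound[of n k] by (simp add: kap_def ge_one_powr_ge_zero)

lemma gm_bound_nonneg: "0 \<le> gm_bound a n"
  using hat_a_le_gm_bound[of n n] hat_a_nonneg[of a n] by simp

lemma gm_bound_antimono:
  assumes "n \<le> n'"
  shows "gm_bound a n' \<le> gm_bound a n"
  unfolding gm_bound_def[of a n']
proof (rule cSUP_least)
  fix k
  show "kap n' k * hat_a a k \<le> gm_bound a n"
    using mult_right_mono[OF kap_antimono[OF assms] hat_a_nonneg] kap_hat_a_le_gm_bound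
    by (rule order_trans)
qed simp

text \<open>A supremum of nonnegative numbers is at most their sum. This gives
  \<open>gm_bound\<close> the form that the Hardy inequality accepts.\<close>

lemma gm_bound_le_suminf: "ennreal (gm_bound a n) \<le> (\<Sum>k. ennreal (kap n k * hat_a a k))"
proof (cases "(\<Sum>k. ennreal (kap n k * hat_a a k)) = top")
  case False
  have "gm_bound a n \<le> enn2real (\<Sum>k. ennreal (kap n k * hat_a a k))"
    unfolding gm_bound_def
  proof (rule cSUP_least)
    fix k
    have "enn2real (ennreal (kap n k * hat_a a k)) \<le> enn2real (\<Sum>k. ennreal (kap n k * hat_a a k))"
      using False by (intro enn2real_mono ennreal_le_suminf) (simp add: less_top)
    thus "kap n k * hat_a a k \<le> enn2real (\<Sum>k. ennreal (kap n k * hat_a a k))"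
      using hat_a_nonneg kap_nonneg by simp
  qed simp
  hence "ennreal (gm_bound a n) \<le> ennreal (enn2real (\<Sum>k. ennreal (kap n k * hat_a a k)))"
    by (rule ennreal_leI)
  thus ?thesis
    using False by (metis ennreal_enn2real less_top)
qed simp

context
  fixes C :: real
  assumes GM: "GM_bar_with C a"
begin

lemma sum_Delta_abs_le: "(\<Sum>m\<in>block n. Delta_abs a m) \<le> C * gm_bound a n"
proof -
  have C: "0 < C" using GM by (simp add: GM_bar_with_def)
  have "ennreal (\<Sum>m\<in>block n. Delta_abs a m) \<le> ennreal C * (SUP k. ennreal (kap n k * hat_a a k))"
    using GM by (simp add: GM_bar_with_def block_def kap_def)
  also have "\<dots> \<le> ennreal C * ennreal (gm_bound a n)"
    by (intro mult_left_mono SUP_least ennreal_leI kap_hat_a_le_gm_bound) auto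
  also have "\<dots> = ennreal (C * gm_bound a n)"
    using C gm_bound_nonneg by (simp add: ennreal_mult)
  finally show ?thesis
    using C gm_bound_nonneg[of n] by (subst (asm) ennreal_le_iff) auto
qed

text \<open>Each ray embeds into the symmetric block. Termwise there is only an inequality, since
  \<open>Delta_abs a 0\<close> counts both neighbours of 0 and a ray sees one.\<close>

lemma one_sided_variation_le:
  assumes "s = 1 \<or> s = - 1"
  shows "(\<Sum>k\<in>{2 ^ n div 2..<2 ^ n}. norm (a (s * int k) - a (s * int (Suc k)))) \<le> C * gm_bound a n"
proof -
  have "(\<Sum>k\<in>{2 ^ n div 2..<2 ^ n}. norm (a (s * int k) - a (s * int (Suc k))))
      \<le> (\<Sum>k\<in>{2 ^ n div 2..<2 ^ n}. Delta_abs a (s * int k))"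
  proof (rule sum_mono)
    fix k
    have "- 1 - int k = - int k - 1" by simp
    thus "norm (a (s * int k) - a (s * int (Suc k))) \<le> Delta_abs a (s * int k)"
      using assms by (auto simp: Delta_abs_def add.commute[of 1] simp del: diff_minus_eq_add)
  qed
  also have "\<dots> = (\<Sum>m\<in>(\<lambda>k. s * int k) ` {2 ^ n div 2..<2 ^ n}. Delta_abs a m)"
    using assms by (subst sum.reindex) (auto simp: inj_on_def)
  also have "\<dots> \<le> (\<Sum>m\<in>block n. Delta_abs a m)"
  proof (rule sum_mono2)
    have "int (2 ^ n div 2) = 2 ^ n div 2" by (simp add: zdiv_int)
    hence "2 ^ n div 2 \<le> int k" "int k < 2 ^ n" if "2 ^ n div 2 \<le> k" "k < 2 ^ n" for k
      using that by (metis of_nat_le_iff, metis of_nat_less_iff of_nat_power of_nat_numeral)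
    thus "(\<lambda>k. s * int k) ` {2 ^ n div 2..<2 ^ n} \<subseteq> block n"
      using assms by (auto simp: block_def abs_mult)
  qed (auto simp: Delta_abs_def)
  also have "\<dots> \<le> C * gm_bound a n" by (rule sum_Delta_abs_le)
  finally show ?thesis .
qed

text \<open>The term \<open>a m\<close> is compared with the average over the block two levels up, since both
  of its end points are covered by the means \<open>hat_a\<close>, even for \<open>n = 0\<close>.\<close>

lemma one_sided_le_gm_bound:
  assumes s: "s = 1 \<or> s = - 1" and m: "2 ^ n div 2 \<le> m" "m < 2 ^ n"
  shows "norm (a (s * int m)) \<le> (3 + 3 * C) * gm_bound a n"
proof -
  define b where "b k = a (s * int k)" for k
  define D where "D i = (\<Sum>k\<in>{2 ^ i div 2..<2 ^ i::nat}. norm (b k - b (Suc k)))" for i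
  have C: "0 < C" using GM by (simp add: GM_bar_with_def)
  have G: "gm_bound a i \<le> gm_bound a n" if "n \<le> i" for i
    using that by (rule gm_bound_antimono)
  have D: "D i \<le> C * gm_bound a n" if "n \<le> i" for i
  proof -
    have "D i \<le> C * gm_bound a i"
      unfolding D_def b_def by (rule one_sided_variation_le[OF s])
    also have "\<dots> \<le> C * gm_bound a n"
      using C G[OF that] by simp
    finally show ?thesis .
  qed
  \<comment> \<open>The indices \<open>m\<close> and \<open>j\<close> lie in blocks \<open>n\<close>
    and \<open>n + 2\<close>, so the path between them stays in three blocks, each of variation at
    most \<open>C * gm_bound a n\<close>.\<close>
  have diff: "norm (b m - b j) \<le> 3 * C * gm_bound a n" if j: "2 ^ (n+1) \<le> j" "j < 2 ^ (n+2)" for j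
  proof -
    have mj: "m \<le> j" using m j by simp
    have "b j - b m = (\<Sum>k\<in>{m..<j}. b (Suc k) - b k)"
      using mj by (simp add: sum_Suc_diff')
    hence "norm (b m - b j) \<le> (\<Sum>k\<in>{m..<j}. norm (b (Suc k) - b k))"
      using norm_sum[of "\<lambda>k. b (Suc k) - b k" "{m..<j}"] by (simp add: norm_minus_commute)
    also have "\<dots> = (\<Sum>k\<in>{m..<j}. norm (b k - b (Suc k)))"
      by (simp add: norm_minus_commute)
    also have "\<dots> \<le> (\<Sum>k\<in>{2 ^ n div 2..<2 ^ (n+2)}. norm (b k - b (Suc k)))"
      using m j by (intro sum_mono2) auto
    also have "\<dots> = D n + D (n+1) + D (n+2)"
    proof -
      have "D n + D (n+1) = (\<Sum>k\<in>{2 ^ n div 2..<2 ^ (n+1)}. norm (b k - b (Suc k)))"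
        unfolding D_def by (simp add: sum.atLeastLessThan_concat)
      thus ?thesis
        unfolding D_def[of "n+2"] by (simp add: sum.atLeastLessThan_concat)
    qed
    also have "\<dots> \<le> 3 * C * gm_bound a n"
      using D[of n] D[of "n+1"] D[of "n+2"] by simp
    finally show ?thesis .
  qed
  have P: "norm (\<Sum>j<2 ^ (i+1). b j) \<le> 2 ^ (i+1) * gm_bound a n" if "n \<le> i" for i
  proof -
    \<comment> \<open>\<open>M\<close> is the last index seen by \<open>hat_a a i\<close>, and its
      normalising factor \<open>M + 1\<close> is exactly \<open>2 ^ (i+1)\<close>.\<close>
    define M where "M = (2::nat) ^ (i+1) - 1"
    have M: "Suc M = 2 ^ (i+1)" by (simp add: M_def)
    have "\<bar>s * int M\<bar> = int M" using s by auto
    moreover have "2 ^ i \<le> int M" "int M < 2 ^ (i+1)"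
      by (auto simp: M_def of_nat_diff)
    ultimately have "norm (psum a (s * int M)) \<le> (of_int (int M) + 1) * hat_a a i"
      using psum_le_hat_a[of i "s * int M" a] by simp
    also have "psum a (s * int M) = (\<Sum>j<2 ^ (i+1). b j)"
      unfolding psum_one_sided[OF s] b_def M[symmetric] lessThan_Suc_atMost ..
    also have "(of_int (int M) + 1 :: real) = 2 ^ (i+1)"
      by (simp add: M_def of_nat_diff)
    also have "(2::real) ^ (i+1) * hat_a a i \<le> 2 ^ (i+1) * gm_bound a n"
      using hat_a_le_gm_bound[OF that] by simp
    finally show ?thesis .
  qed
  \<comment> \<open>Relative to the \<open>2 ^ (n+1)\<close> indices of the average, the differences
    contribute \<open>3 * C\<close> and the two partial sums 2 and 1, whence the constant
    \<open>3 + 3 * C\<close>.\<close>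
  have "of_nat (2 ^ (n+1)) * b m = (\<Sum>j\<in>{2 ^ (n+1)..<2 ^ (n+2)::nat}. b m)"
    by simp
  also have "\<dots> = (\<Sum>j\<in>{2 ^ (n+1)..<2 ^ (n+2)}. b m - b j) + (\<Sum>j\<in>{2 ^ (n+1)..<2 ^ (n+2)}. b j)"
    by (simp add: sum_subtractf)
  also have "(\<Sum>j\<in>{2 ^ (n+1)..<2 ^ (n+2)}. b j) = (\<Sum>j<2 ^ (n+2). b j) - (\<Sum>j<2 ^ (n+1). b j)"
    by (subst sum_diff[symmetric]) (auto intro!: sum.cong)
  finally have eq: "of_nat (2 ^ (n+1)) * b m = (\<Sum>j\<in>{2 ^ (n+1)..<2 ^ (n+2)}. b m - b j) + ((\<Sum>j<2 ^ (n+2). b j) - (\<Sum>j<2 ^ (n+1). b j))" .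
  have "2 ^ (n+1) * norm (b m) = norm (of_nat (2 ^ (n+1)) * b m)"
    by (simp add: norm_mult norm_power)
  also have "\<dots> \<le> norm (\<Sum>j\<in>{2 ^ (n+1)..<2 ^ (n+2)}. b m - b j) + (norm (\<Sum>j<2 ^ (n+2). b j) + norm (\<Sum>j<2 ^ (n+1). b j))"
    unfolding eq by (intro norm_triangle_mono norm_triangle_ineq4) auto
  also have "norm (\<Sum>j\<in>{2 ^ (n+1)..<2 ^ (n+2)}. b m - b j) \<le> of_nat (card {2 ^ (n+1)..<2 ^ (n+2)::nat}) * (3 * C * gm_bound a n)"
    by (intro sum_norm_bound diff) auto
  also have "norm (\<Sum>j<2 ^ (n+2). b j) \<le> 2 ^ (n+2) * gm_bound a n"
    using P[of "n+1"] by simp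
  also have "norm (\<Sum>j<2 ^ (n+1). b j) \<le> 2 ^ (n+1) * gm_bound a n"
    using P[of n] by simp
  finally have "2 ^ (n+1) * norm (b m) \<le> 2 ^ (n+1) * ((3 + 3 * C) * gm_bound a n)"
    by (simp add: algebra_simps)
  thus ?thesis
    unfolding b_def by (subst (asm) mult_le_cancel_left_pos) auto
qed

lemma norm_le_gm_bound:
  assumes "m \<in> block n"
  shows "norm (a m) \<le> (3 + 3 * C) * gm_bound a n"
proof -
  have "2 ^ n div 2 \<le> nat \<bar>m\<bar>" "nat \<bar>m\<bar> < 2 ^ n"
    using assms by (auto simp: block_def nat_less_iff le_nat_iff zdiv_int)
  moreover have "m = (if 0 \<le> m then 1 else - 1) * int (nat \<bar>m\<bar>)"
    by auto
  ultimately show ?thesis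
    using one_sided_le_gm_bound[of "if 0 \<le> m then 1 else - 1" n "nat \<bar>m\<bar>"] by (metis (full_types))
qed

end

end

section \<open>Dyadic decomposition of the weighted coefficient sum\<close>

lemma block_disjoint: "n \<noteq> n' \<Longrightarrow> block n \<inter> block n' = {}"
proof (induction n n' rule: linorder_wlog)
  case (le n n')
  hence "(2::int) ^ Suc n \<le> 2 ^ n'"
    by (intro power_increasing) auto
  thus ?case by (auto simp: block_def)
qed auto

lemma UN_block: "(\<Union>n\<le>N. block n) = {m. \<bar>m\<bar> < 2 ^ N}"
  by (induction N) (auto simp: atMost_Suc block_def)

lemma sum_abs_less_power: "(\<Sum>m | \<bar>m\<bar> < 2 ^ N. g m) = (\<Sum>n\<le>N. \<Sum>m\<in>block n. g m)"
  unfolding UN_block[symmetric]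
  by (intro sum.UNION_disjoint) (auto simp: block_disjoint)

text \<open>Every finite set of integers lies in some \<open>{m. \<bar>m\<bar> < 2 ^ N}\<close>,
  which is a finite union of whole blocks; with nonnegative terms both sides are therefore the same
  supremum.\<close>

lemma infsum_eq_suminf_block:
  fixes g :: "int \<Rightarrow> ennreal"
  shows "(\<Sum>\<^sub>\<infinity>k. g k) = (\<Sum>n. \<Sum>m\<in>block n. g m)"
proof (rule antisym)
  show "(\<Sum>\<^sub>\<infinity>k. g k) \<le> (\<Sum>n. \<Sum>m\<in>block n. g m)"
  proof (subst nonneg_infsum_complete, simp, rule SUP_least)
    fix F :: "int set" assume "F \<in> {F. finite F \<and> F \<subseteq> UNIV}"
    hence F: "finite F" by simp
    define N where "N = Max (insert 0 ((\<lambda>m. nat \<bar>m\<bar>) ` F))"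
    have "F \<subseteq> {m. \<bar>m\<bar> < 2 ^ N}"
    proof
      fix m assume "m \<in> F"
      hence "nat \<bar>m\<bar> \<le> N" unfolding N_def using F by (intro Max_ge) auto
      hence "\<bar>m\<bar> \<le> int N" by simp
      also have "int N < int (2 ^ N)"
        using less_exp[of N] by (rule of_nat_less_iff[THEN iffD2])
      finally show "m \<in> {m. \<bar>m\<bar> < 2 ^ N}" by simp
    qed
    hence "sum g F \<le> sum g {m. \<bar>m\<bar> < 2 ^ N}"
      unfolding UN_block[symmetric] by (intro sum_mono2) auto
    also have "\<dots> \<le> (\<Sum>n. \<Sum>m\<in>block n. g m)"
      unfolding sum_abs_less_power by (intro sum_le_suminf summableI) auto
    finally show "sum g F \<le> (\<Sum>n. \<Sum>m\<in>block n. g m)" .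
  qed
  show "(\<Sum>n. \<Sum>m\<in>block n. g m) \<le> (\<Sum>\<^sub>\<infinity>k. g k)"
  proof (rule suminf_le_const[OF summableI])
    fix N
    have fin: "finite {m::int. \<bar>m\<bar> < 2 ^ N}"
      unfolding UN_block[symmetric] by simp
    have "(\<Sum>n<N. \<Sum>m\<in>block n. g m) \<le> (\<Sum>n\<le>N. \<Sum>m\<in>block n. g m)"
      by (intro sum_mono2) auto
    also have "\<dots> = sum g {m. \<bar>m\<bar> < 2 ^ N}"
      by (simp add: sum_abs_less_power)
    also have "\<dots> \<le> (\<Sum>\<^sub>\<infinity>k. g k)"
      using fin by (subst nonneg_infsum_complete) (auto intro!: SUP_upper)
    finally show "(\<Sum>n<N. \<Sum>m\<in>block n. g m) \<le> (\<Sum>\<^sub>\<infinity>k. g k)" .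
  qed
qed

lemma card_block_le: "real (card (block n)) \<le> 2 ^ n"
proof (cases n)
  case 0
  have "block 0 = {0}" by (auto simp: block_def)
  thus ?thesis using 0 by simp
next
  case (Suc k)
  have "block n \<subseteq> {2 ^ k..<2 ^ Suc k} \<union> {- (2 ^ Suc k)<..- (2 ^ k)}"
    by (auto simp: block_def Suc)
  hence "card (block n) \<le> card ({2 ^ k..<2 ^ Suc k} \<union> {- (2 ^ Suc k)<..- (2 ^ k :: int)})"
    by (intro card_mono) auto
  also have "\<dots> \<le> card {2 ^ k..<2 ^ Suc k :: int} + card {- (2 ^ Suc k)<..- (2 ^ k :: int)}"
    by (rule card_Un_le)
  also have "\<dots> = 2 ^ n"
    by (simp add: Suc nat_power_eq)
  finally have "real (card (block n)) \<le> real (2 ^ n)"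
    by (simp only: of_nat_le_iff)
  thus ?thesis by simp
qed

lemma power2_powr: "(2 ^ n :: real) powr q = 2 powr (real n * q)"
  by (metis powr_powr powr_realpow zero_less_numeral)

text \<open>The constant contains \<bar>q\<bar> because the exponent \<open>p - 2\<close>, for which
  this is meant, is negative when \<open>p < 2\<close>.\<close>

lemma powr_comparable:
  fixes x y q :: real
  assumes "0 < x" "x / 2 \<le> y" "y \<le> x"
  shows "y powr q \<le> 2 powr \<bar>q\<bar> * x powr q" "x powr q \<le> 2 powr \<bar>q\<bar> * y powr q"
proof -
  have y: "0 < y" using assms by simp
  have one: "1 \<le> 2 powr \<bar>q\<bar>" by (simp add: ge_one_powr_ge_zero)
  have *: "u powr q \<le> 2 powr \<bar>q\<bar> * v powr q" if "0 < u" "0 < v" "u \<le> 2 * v" "v \<le> 2 * u" for u v :: real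
  proof (cases "0 \<le> q")
    case True
    hence "u powr q \<le> (2 * v) powr q" using that by (intro powr_mono2) auto
    thus ?thesis using True that by (simp add: powr_mult)
  next
    case False
    hence "u powr q \<le> (v / 2) powr q" using that by (intro powr_mono2') auto
    thus ?thesis using False that by (simp add: powr_divide powr_minus_divide)
  qed
  show "y powr q \<le> 2 powr \<bar>q\<bar> * x powr q" "x powr q \<le> 2 powr \<bar>q\<bar> * y powr q"
    using assms y by (auto intro!: *)
qed

lemma block_weight:
  assumes "m \<in> block n"
  shows "(of_int \<bar>m\<bar> + 1) powr q \<le> 2 powr \<bar>q\<bar> * 2 powr (real n * q)"
    and "2 powr (real n * q) \<le> 2 powr \<bar>q\<bar> * (of_int \<bar>m\<bar> + 1) powr q"
proof -
  have "2 ^ n \<le> 2 * (\<bar>m\<bar> + 1)" "\<bar>m\<bar> + 1 \<le> 2 ^ n"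
    using assms by (auto simp: block_def)
  hence "real_of_int (2 ^ n) \<le> of_int (2 * (\<bar>m\<bar> + 1))" "of_int (\<bar>m\<bar> + 1) \<le> real_of_int (2 ^ n)"
    by (simp_all only: of_int_le_iff)
  hence "2 ^ n / 2 \<le> real_of_int \<bar>m\<bar> + 1" "real_of_int \<bar>m\<bar> + 1 \<le> 2 ^ n"
    by auto
  note * = powr_comparable[OF _ this, of q]
  thus "(of_int \<bar>m\<bar> + 1) powr q \<le> 2 powr \<bar>q\<bar> * 2 powr (real n * q)"
    and "2 powr (real n * q) \<le> 2 powr \<bar>q\<bar> * (of_int \<bar>m\<bar> + 1) powr q"
    using * by (auto simp: power2_powr)
qed

definition Jseq :: "real \<Rightarrow> (int \<Rightarrow> complex) \<Rightarrow> ennreal" where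
  "Jseq p a = (\<Sum>\<^sub>\<infinity>k::int. ennreal ((of_int \<bar>k\<bar> + 1) powr (p - 2) * norm (a k) powr p))"

lemma Jseq_le_wsum:
  assumes p: "1 < p" and c: "0 \<le> c" "\<And>n. 0 \<le> G n" and le: "\<And>n m. m \<in> block n \<Longrightarrow> norm (a m) \<le> c * G n"
  shows "Jseq p a \<le> ennreal (2 powr \<bar>p - 2\<bar> * c powr p) * wsum p G"
proof -
  define K where "K = 2 powr \<bar>p - 2\<bar> * c powr p"
  have "(\<Sum>m\<in>block n. (of_int \<bar>m\<bar> + 1) powr (p - 2) * norm (a m) powr p) \<le> K * (2 powr (real n * (p - 1)) * G n powr p)" for n
  proof -
    define t where "t = 2 powr \<bar>p - 2\<bar> * 2 powr (real n * (p - 2)) * (c * G n) powr p"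
    have "(\<Sum>m\<in>block n. (of_int \<bar>m\<bar> + 1) powr (p - 2) * norm (a m) powr p) \<le> of_nat (card (block n)) * t"
      unfolding t_def using p c
      by (intro sum_bounded_above mult_mono block_weight powr_mono2 le) auto
    also have "\<dots> \<le> 2 ^ n * t"
      using card_block_le[of n] c by (intro mult_right_mono) (auto simp: t_def)
    also have "\<dots> = K * (2 powr (real n * (p - 1)) * G n powr p)"
    proof -
      have "(2::real) ^ n * 2 powr (real n * (p - 2)) = 2 powr (real n) * 2 powr (real n * (p - 2))"
        by (simp add: powr_realpow)
      also have "\<dots> = 2 powr (real n * (p - 1))"
        by (simp add: powr_add[symmetric] algebra_simps)
      finally show ?thesis using c by (simp add: t_def K_def powr_mult)
    qed
    finally show ?thesis .
  qed
  hence "Jseq p a \<le> (\<Sum>n. ennreal (K * (2 powr (real n * (p - 1)) * G n powr p)))"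
    unfolding Jseq_def infsum_eq_suminf_block
    by (intro suminf_le summableI) (simp add: sum_ennreal ennreal_leI)
  also have "\<dots> = ennreal K * wsum p G"
    using c by (simp add: wsum_def ennreal_mult' K_def)
  finally show ?thesis by (simp add: K_def)
qed

definition block_mean :: "(int \<Rightarrow> complex) \<Rightarrow> nat \<Rightarrow> real" where
  "block_mean a n = (\<Sum>m\<in>block n. norm (a m)) / 2 ^ n"

lemma block_mean_nonneg: "0 \<le> block_mean a n"
  by (simp add: block_mean_def sum_nonneg)

text \<open>The power bound is applied to the counting measure on a block, of total mass at most
  \<open>2 ^ n\<close>. The exponents of 2 combine to
  \<open>n * (p - 1) - n * p + n * (p - 1) = n * (p - 2)\<close>, the weight in
  \<open>Jseq\<close>.\<close>

lemma wsum_block_mean_le: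
  assumes p: "1 < p"
  shows "wsum p (block_mean a) \<le> ennreal (2 powr p * 2 powr \<bar>p - 2\<bar>) * Jseq p a"
proof -
  have "ennreal (2 powr (real n * (p - 1)) * block_mean a n powr p)
      \<le> ennreal (2 powr p * 2 powr \<bar>p - 2\<bar>) * (\<Sum>m\<in>block n. ennreal ((of_int \<bar>m\<bar> + 1) powr (p - 2) * norm (a m) powr p))" for n
  proof -
    define F where "F = (\<Sum>m\<in>block n. norm (a m))"
    define S where "S = (\<Sum>m\<in>block n. norm (a m) powr p)"
    have F: "0 \<le> F" "0 \<le> S" by (auto simp: F_def S_def sum_nonneg)
    have "ennreal (F powr p) \<le> ennreal (2 powr p * (2 ^ n) powr (p - 1)) * (\<integral>\<^sup>+m. ennreal (norm (a m) powr p) \<partial>count_space (block n))"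
    proof (rule nn_integral_powr_ge[OF p])
      show "emeasure (count_space (block n)) (space (count_space (block n))) \<le> ennreal (2 ^ n)"
        using ennreal_leI[OF card_block_le[of n]] by (simp add: emeasure_count_space ennreal_of_nat_eq_real_of_nat)
      show "ennreal F = (\<integral>\<^sup>+m. ennreal (norm (a m)) \<partial>count_space (block n))"
        by (simp add: F_def nn_integral_count_space_finite sum_ennreal)
    qed (use F in auto)
    also have "(\<integral>\<^sup>+m. ennreal (norm (a m) powr p) \<partial>count_space (block n)) = ennreal S"
      by (simp add: S_def nn_integral_count_space_finite sum_ennreal)
    finally have FS: "F powr p \<le> 2 powr p * (2 ^ n) powr (p - 1) * S"
      using F by (simp add: ennreal_mult''[symmetric])
    have "2 powr (real n * (p - 1)) * block_mean a n powr p = 2 powr (real n * (p - 1)) * F powr p / 2 powr (real n * p)"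
      using F by (simp add: block_mean_def F_def[symmetric] powr_divide power2_powr)
    also have "\<dots> = 2 powr (- real n) * F powr p"
    proof -
      have "2 powr (real n * (p - 1)) = 2 powr (- real n) * 2 powr (real n * p)"
        by (simp add: powr_add[symmetric] algebra_simps)
      thus ?thesis by simp
    qed
    also have "\<dots> \<le> 2 powr (- real n) * (2 powr p * (2 ^ n) powr (p - 1) * S)"
      by (intro mult_left_mono FS) auto
    also have "\<dots> = 2 powr p * (2 powr (real n * (p - 2)) * S)"
    proof -
      have "2 powr (real n * (p - 2)) = 2 powr (- real n) * 2 powr (real n * (p - 1))"
        by (simp add: powr_add[symmetric] algebra_simps)
      thus ?thesis unfolding power2_powr by simp
    qed
    also have "2 powr (real n * (p - 2)) * S \<le> 2 powr \<bar>p - 2\<bar> * (\<Sum>m\<in>block n. (of_int \<bar>m\<bar> + 1) powr (p - 2) * norm (a m) powr p)"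
      unfolding S_def sum_distrib_left mult.assoc[symmetric]
      by (intro sum_mono mult_right_mono block_weight) auto
    finally have "2 powr (real n * (p - 1)) * block_mean a n powr p \<le> 2 powr p * 2 powr \<bar>p - 2\<bar> * (\<Sum>m\<in>block n. (of_int \<bar>m\<bar> + 1) powr (p - 2) * norm (a m) powr p)"
      by simp
    hence "ennreal (2 powr (real n * (p - 1)) * block_mean a n powr p) \<le> ennreal (2 powr p * 2 powr \<bar>p - 2\<bar> * (\<Sum>m\<in>block n. (of_int \<bar>m\<bar> + 1) powr (p - 2) * norm (a m) powr p))"
      by (rule ennreal_leI)
    also have "\<dots> = ennreal (2 powr p * 2 powr \<bar>p - 2\<bar>) * (\<Sum>m\<in>block n. ennreal ((of_int \<bar>m\<bar> + 1) powr (p - 2) * norm (a m) powr p))"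
      by (subst sum_ennreal) (auto simp: ennreal_mult' sum_nonneg)
    finally show ?thesis .
  qed
  hence "wsum p (block_mean a) \<le> (\<Sum>n. ennreal (2 powr p * 2 powr \<bar>p - 2\<bar>) * (\<Sum>m\<in>block n. ennreal ((of_int \<bar>m\<bar> + 1) powr (p - 2) * norm (a m) powr p)))"
    unfolding wsum_def by (intro suminf_le summableI)
  also have "\<dots> = ennreal (2 powr p * 2 powr \<bar>p - 2\<bar>) * Jseq p a"
    unfolding Jseq_def infsum_eq_suminf_block by simp
  finally show ?thesis .
qed

text \<open>The indices of the partial sum lie in the blocks up to \<open>Suc k\<close>, and
  division by at least \<open>2 ^ k\<close> leaves the factor \<open>2 powr (n - k)\<close> before
  the n-th mean. The constant 2 is due to the block \<open>n = Suc k\<close>, where this factor is 2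
  and the kernel is 1.\<close>

lemma hat_a_le_block_mean: "ennreal (hat_a a k) \<le> ennreal 2 * (\<Sum>n. ennreal (kap k n * block_mean a n))"
proof -
  define S where "S = (\<Sum>n\<le>Suc k. 2 * (kap k n * block_mean a n))"
  have "hat_a a k \<le> S"
  proof (rule hat_a_leI)
    fix m :: int assume m: "2 ^ k \<le> \<bar>m\<bar>" "\<bar>m\<bar> < 2 ^ (k + 1)"
    have fin: "finite {j::int. \<bar>j\<bar> < 2 ^ Suc k}"
      unfolding UN_block[symmetric] by simp
    have "norm (psum a m) \<le> (\<Sum>j | \<bar>j\<bar> < 2 ^ Suc k. norm (a j))"
      unfolding psum_def using m
      by (auto intro!: order_trans[OF norm_sum] sum_mono2 fin[simplified])
    also have "\<dots> = (\<Sum>n\<le>Suc k. 2 ^ n * block_mean a n)"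
      unfolding sum_abs_less_power block_mean_def by simp
    also have "\<dots> \<le> (\<Sum>n\<le>Suc k. 2 ^ k * (2 * (kap k n * block_mean a n)))"
    proof (rule sum_mono)
      fix n assume "n \<in> {..Suc k}"
      have "2 ^ n \<le> 2 ^ k * (2 * kap k n)"
      proof (cases "n = Suc k")
        case False
        hence "n \<le> k" using \<open>n \<in> _\<close> by simp
        hence "kap k n = 2 ^ n / 2 ^ k"
          by (simp add: kap_def powr_diff powr_realpow)
        thus ?thesis by simp
      qed (simp add: kap_def)
      thus "2 ^ n * block_mean a n \<le> 2 ^ k * (2 * (kap k n * block_mean a n))"
        using mult_right_mono[OF _ block_mean_nonneg] by (simp add: mult.assoc[symmetric])
    qed
    also have "\<dots> = 2 ^ k * S"
      unfolding S_def sum_distrib_left ..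
    finally have "norm (psum a m) \<le> 2 ^ k * S" .
    moreover have "0 \<le> S"
      unfolding S_def by (intro sum_nonneg mult_nonneg_nonneg kap_nonneg block_mean_nonneg) auto
    moreover have "2 ^ k \<le> real_of_int \<bar>m\<bar> + 1"
      using m(1) by (metis of_int_le_iff of_int_numeral of_int_power le_add_same_cancel1 order_trans zero_le_one)
    ultimately have "norm (psum a m) \<le> (real_of_int \<bar>m\<bar> + 1) * S"
      using mult_right_mono by (blast intro: order_trans)
    thus "norm (psum a m) / (of_int \<bar>m\<bar> + 1) \<le> S"
      by (simp add: divide_le_eq add_nonneg_pos mult.commute)
  qed
  hence "ennreal (hat_a a k) \<le> ennreal S" by (rule ennreal_leI)
  also have "\<dots> = (\<Sum>n\<le>Suc k. ennreal 2 * ennreal (kap k n * block_mean a n))"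
    unfolding S_def by (subst sum_ennreal[symmetric]) (auto simp: ennreal_mult'' kap_nonneg block_mean_nonneg)
  also have "\<dots> \<le> (\<Sum>n. ennreal 2 * ennreal (kap k n * block_mean a n))"
    by (intro sum_le_suminf summableI) auto
  finally show ?thesis by simp
qed

section \<open>Abel summation\<close>

lemma sum_lessThan_power2:
  "(\<Sum>k<2 ^ J. g k) = (\<Sum>n\<le>J. \<Sum>k\<in>{2 ^ n div 2..<2 ^ n}. g k)" for g :: "nat \<Rightarrow> 'a :: comm_monoid_add"
proof (induction J)
  case (Suc J)
  have "(\<Sum>k<2 ^ Suc J. g k) = (\<Sum>k<2 ^ J. g k) + (\<Sum>k\<in>{2 ^ J..<2 ^ Suc J}. g k)"
    unfolding lessThan_atLeast0 by (rule sum.atLeastLessThan_concat[symmetric]) auto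
  thus ?case using Suc by simp
qed (simp add: lessThan_Suc)

lemma sum_power2_interval:
  fixes g :: "nat \<Rightarrow> 'a :: comm_monoid_add"
  assumes "j \<le> J"
  shows "(\<Sum>k\<in>{2 ^ j..<2 ^ J}. g k) = (\<Sum>n\<in>{Suc j..J}. \<Sum>k\<in>{2 ^ n div 2..<2 ^ n}. g k)"
  using assms
proof (induction J rule: dec_induct)
  case (step J)
  have "(\<Sum>k\<in>{2 ^ j..<2 ^ Suc J}. g k) = (\<Sum>k\<in>{2 ^ j..<2 ^ J}. g k) + (\<Sum>k\<in>{2 ^ J..<2 ^ Suc J}. g k)"
    using step by (intro sum.atLeastLessThan_concat[symmetric]) (auto intro: power_increasing)
  thus ?case using step by simp
qed simp

lemma dyadic_index:
  assumes "2 ^ j \<le> (k :: nat)"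
  obtains n where "j < n" "k \<in> {2 ^ n div 2..<2 ^ n}"
proof -
  define n where "n = (LEAST n. k < 2 ^ n)"
  have ex: "k < 2 ^ k" by (rule less_exp)
  have n: "k < 2 ^ n" unfolding n_def using ex by (rule LeastI)
  have "(2::nat) ^ j < 2 ^ n" using assms n by (rule le_less_trans)
  hence jn: "j < n" by simp
  then obtain n' where n': "n = Suc n'" by (cases n) auto
  have "\<not> k < 2 ^ n'"
    using not_less_Least[of n' "\<lambda>n. k < 2 ^ n"] n' by (simp add: n_def)
  thus ?thesis using that[of n] jn n n' by auto
qed

lemma abel_summation:
  fixes b :: "nat \<Rightarrow> complex"
  assumes "M \<le> N"
  shows "(1 - z) * (\<Sum>k\<in>{M..<N}. b k * z ^ k) =
    b M * z ^ M - b N * z ^ N - (\<Sum>k\<in>{M..<N}. (b k - b (Suc k)) * z ^ Suc k)"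
  using assms
proof (induction N rule: dec_induct)
  case (step N)
  thus ?case by (simp add: algebra_simps)
qed simp

context
  fixes G :: "nat \<Rightarrow> real"
  assumes G: "\<And>n. 0 \<le> G n" "summable G"
begin

lemma summable_kap: "summable (\<lambda>n. kap j n * G n)"
  by (rule summable_comparison_test'[OF G(2), of 0])
     (auto simp: abs_mult kap_nonneg G intro!: mult_left_le_one_le kap_le_1)

lemma sum_kap_le: "finite I \<Longrightarrow> (\<Sum>n\<in>I. kap j n * G n) \<le> (\<Sum>n. kap j n * G n)"
  by (intro sum_le_suminf summable_kap) (auto intro: mult_nonneg_nonneg kap_nonneg G)

lemma G_le_kap: "j \<le> n \<Longrightarrow> G n \<le> (\<Sum>n. kap j n * G n)"
  using sum_kap_le[of "{n}" j] by (simp add: kap_def ge_one_powr_ge_zero)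

lemma suminf_kap_nonneg: "0 \<le> (\<Sum>n. kap j n * G n)"
  using sum_kap_le[of "{}" j] by simp

context
  fixes b :: "nat \<Rightarrow> complex" and c :: real
  assumes c: "0 \<le> c"
    and b_le: "\<And>n k. k \<in> {2 ^ n div 2..<2 ^ n} \<Longrightarrow> norm (b k) \<le> c * G n"
    and var_le: "\<And>n. (\<Sum>k\<in>{2 ^ n div 2..<2 ^ n}. norm (b k - b (Suc k))) \<le> c * G n"
begin

lemma norm_le_tail: "2 ^ j \<le> k \<Longrightarrow> norm (b k) \<le> c * (\<Sum>n. kap j n * G n)"
proof -
  assume "2 ^ j \<le> k"
  then obtain n where n: "j < n" "k \<in> {2 ^ n div 2..<2 ^ n}" by (rule dyadic_index)
  have "norm (b k) \<le> c * G n" by (rule b_le[OF n(2)])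
  also have "\<dots> \<le> c * (\<Sum>n. kap j n * G n)"
    using n by (intro mult_left_mono G_le_kap c) auto
  finally show ?thesis .
qed

text \<open>Beyond \<open>2 ^ j\<close> only blocks above \<open>j\<close> occur, and there the
  kernel is 1. The level \<open>j + N\<close> merely provides a power of 2 that exceeds
  \<open>N\<close>.\<close>

lemma variation_le_tail: "(\<Sum>k\<in>{2 ^ j..<N}. norm (b k - b (Suc k))) \<le> c * (\<Sum>n. kap j n * G n)"
proof -
  have "N \<le> 2 ^ (j + N)"
    using less_exp[of "j + N"] by linarith
  hence "(\<Sum>k\<in>{2 ^ j..<N}. norm (b k - b (Suc k))) \<le> (\<Sum>k\<in>{2 ^ j..<2 ^ (j + N)}. norm (b k - b (Suc k)))"
    by (intro sum_mono2) auto
  also have "\<dots> = (\<Sum>n\<in>{Suc j..j + N}. \<Sum>k\<in>{2 ^ n div 2..<2 ^ n}. norm (b k - b (Suc k)))"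
    by (rule sum_power2_interval) simp
  also have "\<dots> \<le> (\<Sum>n\<in>{Suc j..j + N}. c * (kap j n * G n))"
  proof (rule sum_mono)
    fix n assume "n \<in> {Suc j..j + N}"
    hence "kap j n = 1" by (simp add: kap_def ge_one_powr_ge_zero)
    thus "(\<Sum>k\<in>{2 ^ n div 2..<2 ^ n}. norm (b k - b (Suc k))) \<le> c * (kap j n * G n)"
      using var_le[of n] by simp
  qed
  also have "\<dots> = c * (\<Sum>n\<in>{Suc j..j + N}. kap j n * G n)"
    by (simp add: sum_distrib_left)
  also have "\<dots> \<le> c * (\<Sum>n. kap j n * G n)"
    by (intro mult_left_mono sum_kap_le c) auto
  finally show ?thesis .
qed

text \<open>The complementary range: a block with \<open>n \<le> j\<close> has at most
  \<open>2 ^ n = 2 ^ j * kap j n\<close> indices, so the same average of \<open>G\<close>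
  reappears.\<close>

lemma initial_sum_le: "(\<Sum>k<2 ^ j. norm (b k)) \<le> 2 ^ j * (c * (\<Sum>n. kap j n * G n))"
proof -
  have "(\<Sum>k<2 ^ j. norm (b k)) = (\<Sum>n\<le>j. \<Sum>k\<in>{2 ^ n div 2..<2 ^ n}. norm (b k))"
    by (rule sum_lessThan_power2)
  also have "\<dots> \<le> (\<Sum>n\<le>j. 2 ^ j * (c * (kap j n * G n)))"
  proof (rule sum_mono)
    fix n assume "n \<in> {..j}"
    hence kap: "kap j n = 2 ^ n / 2 ^ j"
      by (simp add: kap_def powr_diff powr_realpow)
    have "(\<Sum>k\<in>{2 ^ n div 2..<2 ^ n}. norm (b k)) \<le> of_nat (card {2 ^ n div 2..<2 ^ n::nat}) * (c * G n)"
      by (rule sum_bounded_above) (rule b_le)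
    also have "\<dots> \<le> 2 ^ n * (c * G n)"
    proof (rule mult_right_mono)
      have "card {2 ^ n div 2..<2 ^ n::nat} \<le> 2 ^ n" by simp
      hence "real (card {2 ^ n div 2..<2 ^ n::nat}) \<le> real (2 ^ n)" by (simp only: of_nat_le_iff)
      thus "real (card {2 ^ n div 2..<2 ^ n::nat}) \<le> 2 ^ n" by simp
    qed (use c G in simp)
    finally show "(\<Sum>k\<in>{2 ^ n div 2..<2 ^ n}. norm (b k)) \<le> 2 ^ j * (c * (kap j n * G n))"
      by (simp add: kap mult_ac)
  qed
  also have "\<dots> = 2 ^ j * (c * (\<Sum>n\<le>j. kap j n * G n))"
    by (simp add: sum_distrib_left)
  also have "\<dots> \<le> 2 ^ j * (c * (\<Sum>n. kap j n * G n))"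
    by (intro mult_left_mono sum_kap_le c) auto
  finally show ?thesis .
qed

text \<open>The sum is cut at \<open>2 ^ j\<close>, the scale of \<open>1 / norm (1 - z)\<close>.
  The head is estimated termwise and costs 1. Abel summation bounds the tail times
  \<open>1 - z\<close> by two boundary terms and one variation, so the tail costs
  \<open>3 * 2 = 6\<close>; together 7, uniformly in \<open>N\<close>.\<close>

lemma norm_power_sum_le:
  assumes z: "norm z = 1" "1 / 2 ^ Suc j \<le> norm (1 - z)"
  shows "norm (\<Sum>k<N. b k * z ^ k) \<le> 7 * (2 ^ j * (c * (\<Sum>n. kap j n * G n)))"
proof -
  define E where "E = c * (\<Sum>n. kap j n * G n)"
  have E: "0 \<le> E" using c suminf_kap_nonneg by (simp add: E_def)
  have nz: "norm (b k * z ^ k) = norm (b k)" "norm (w * z ^ k) = norm w" for k w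
    using z by (simp_all add: norm_mult norm_power)
  have init: "norm (\<Sum>k<M. b k * z ^ k) \<le> 2 ^ j * E" if "M \<le> 2 ^ j" for M
  proof -
    have "norm (\<Sum>k<M. b k * z ^ k) \<le> (\<Sum>k<M. norm (b k))"
      by (rule order_trans[OF norm_sum]) (simp add: nz)
    also have "\<dots> \<le> (\<Sum>k<2 ^ j. norm (b k))"
      using that by (intro sum_mono2) auto
    also have "\<dots> \<le> 2 ^ j * E"
      using initial_sum_le by (simp add: E_def)
    finally show ?thesis .
  qed
  show ?thesis
  proof (cases "N \<le> 2 ^ j")
    case True
    have "0 \<le> 2 ^ j * E" using E by simp
    thus ?thesis using init[OF True] unfolding E_def[symmetric] by linarith
  next
    case False
    define S where "S = (\<Sum>k\<in>{2 ^ j..<N}. b k * z ^ k)"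
    have "norm ((1 - z) * S) = norm (b (2 ^ j) * z ^ (2 ^ j) - b N * z ^ N - (\<Sum>k\<in>{2 ^ j..<N}. (b k - b (Suc k)) * z ^ Suc k))"
      unfolding S_def using False by (subst abel_summation) auto
    also have "\<dots> \<le> norm (b (2 ^ j) * z ^ (2 ^ j)) + norm (b N * z ^ N) + norm (\<Sum>k\<in>{2 ^ j..<N}. (b k - b (Suc k)) * z ^ Suc k)"
      by (intro order_trans[OF norm_triangle_ineq4] add_right_mono norm_triangle_ineq4)
    also have "norm (\<Sum>k\<in>{2 ^ j..<N}. (b k - b (Suc k)) * z ^ Suc k) \<le> (\<Sum>k\<in>{2 ^ j..<N}. norm (b k - b (Suc k)))"
      by (rule order_trans[OF norm_sum]) (simp only: nz order_refl)
    also have "\<dots> \<le> E" unfolding E_def by (rule variation_le_tail)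
    also have "norm (b (2 ^ j) * z ^ (2 ^ j)) \<le> E"
      unfolding nz E_def by (rule norm_le_tail) simp
    also have "norm (b N * z ^ N) \<le> E"
      unfolding nz E_def using False by (intro norm_le_tail) simp
    finally have "norm (1 - z) * norm S \<le> 3 * E"
      by (simp add: norm_mult)
    moreover have "1 / 2 ^ Suc j * norm S \<le> norm (1 - z) * norm S"
      by (intro mult_right_mono z) auto
    ultimately have "1 / 2 ^ Suc j * norm S \<le> 3 * E" by linarith
    hence S: "norm S \<le> 6 * (2 ^ j * E)"
      by (simp add: field_simps)
    have "(\<Sum>k<N. b k * z ^ k) = (\<Sum>k<2 ^ j. b k * z ^ k) + S"
      unfolding S_def lessThan_atLeast0 using False by (intro sum.atLeastLessThan_concat[symmetric]) auto
    hence "norm (\<Sum>k<N. b k * z ^ k) \<le> norm (\<Sum>k<2 ^ j. b k * z ^ k) + norm S"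
      by (simp add: norm_triangle_ineq)
    thus ?thesis using init[of "2 ^ j"] S unfolding E_def[symmetric] by simp
  qed
qed

lemma one_sided_tendsto_0: "b \<longlonglongrightarrow> 0"
proof (rule LIMSEQ_I)
  fix e :: real assume e: "0 < e"
  have "(\<lambda>n. c * G n) \<longlonglongrightarrow> c * 0"
    by (intro tendsto_intros summable_LIMSEQ_zero G)
  hence "\<forall>\<^sub>F n in sequentially. c * G n < e"
    using e by (intro order_tendstoD(2)) auto
  then obtain j where j: "\<And>n. j \<le> n \<Longrightarrow> c * G n < e"
    by (auto simp: eventually_sequentially)
  show "\<exists>no. \<forall>k\<ge>no. norm (b k - 0) < e"
  proof (intro exI allI impI)
    fix k :: nat assume "2 ^ j \<le> k"
    then obtain n where "j < n" "k \<in> {2 ^ n div 2..<2 ^ n}" by (rule dyadic_index)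
    thus "norm (b k - 0) < e" using b_le[of k n] j[of n] by simp
  qed
qed

text \<open>Abel summation in the limit: the boundary term tends to 0 and the series of differences
  converges absolutely; division by \<open>1 - z\<close> returns the partial sums.\<close>

lemma power_series_summable:
  assumes z: "norm z = 1" "z \<noteq> 1"
  shows "summable (\<lambda>k. b k * z ^ k)"
proof -
  \<comment> \<open>The shift by one is there because the variation bound with \<open>j = 0\<close>
    starts at the index \<open>2 ^ 0 = 1\<close>.\<close>
  have "summable (\<lambda>k. norm ((b (Suc k) - b (Suc (Suc k))) * z ^ Suc (Suc k)))"
  proof (rule bounded_imp_summable)
    fix N
    have "(\<Sum>k\<le>N. norm ((b (Suc k) - b (Suc (Suc k))) * z ^ Suc (Suc k))) = (\<Sum>k\<in>{2 ^ 0..<Suc (Suc N)}. norm (b k - b (Suc k)))"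
      by (rule sum.reindex_bij_witness[of _ "\<lambda>k. k - 1" Suc]) (auto simp: norm_mult norm_power z)
    also have "\<dots> \<le> c * (\<Sum>n. kap 0 n * G n)" by (rule variation_le_tail)
    finally show "(\<Sum>k\<le>N. norm ((b (Suc k) - b (Suc (Suc k))) * z ^ Suc (Suc k))) \<le> c * (\<Sum>n. kap 0 n * G n)" .
  qed simp
  hence "summable (\<lambda>k. (b (Suc k) - b (Suc (Suc k))) * z ^ Suc (Suc k))"
    by (rule summable_norm_cancel)
  hence "summable (\<lambda>k. (b k - b (Suc k)) * z ^ Suc k)"
    by (subst (asm) summable_Suc_iff[of "\<lambda>k. (b k - b (Suc k)) * z ^ Suc k"])
  then obtain s where s: "(\<lambda>N. \<Sum>k<N. (b k - b (Suc k)) * z ^ Suc k) \<longlonglongrightarrow> s"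
    by (auto simp: summable_def sums_def)
  have "(\<lambda>N. norm (b N * z ^ N)) \<longlonglongrightarrow> 0"
    using tendsto_norm[OF one_sided_tendsto_0] z by (simp add: norm_mult norm_power)
  hence bz: "(\<lambda>N. b N * z ^ N) \<longlonglongrightarrow> 0"
    by (rule tendsto_norm_zero_cancel)
  have "(\<lambda>N. (b 0 * z ^ 0 - b N * z ^ N - (\<Sum>k<N. (b k - b (Suc k)) * z ^ Suc k)) / (1 - z)) \<longlonglongrightarrow> (b 0 * z ^ 0 - 0 - s) / (1 - z)"
    using z by (intro tendsto_intros s bz) auto
  moreover have "(b 0 * z ^ 0 - b N * z ^ N - (\<Sum>k<N. (b k - b (Suc k)) * z ^ Suc k)) / (1 - z) = (\<Sum>k<N. b k * z ^ k)" for N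
    using abel_summation[of 0 N z b] z unfolding lessThan_atLeast0 by (simp add: nonzero_divide_eq_eq mult.commute)
  ultimately show ?thesis
    by (auto simp: summable_def sums_def)
qed

end

end

section \<open>Uniqueness of Fourier coefficients\<close>

lemma integrable_mult_bounded_continuous:
  fixes h :: "real \<Rightarrow> complex"
  assumes "integrable lborel h" and \<psi>: "continuous_on UNIV \<psi>" "\<And>x. norm (\<psi> x) \<le> B"
  shows "integrable lborel (\<lambda>x. h x * \<psi> x)"
proof (rule Bochner_Integration.integrable_bound)
  show "integrable lborel (\<lambda>x. B * norm (h x))"
    using assms(1) by auto
  have [measurable]: "\<psi> \<in> borel_measurable borel"
    using \<psi>(1) by (rule borel_measurable_continuous_onI)
  show "(\<lambda>x. h x * \<psi> x) \<in> borel_measurable lborel"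
    using assms(1) by measurable
  show "AE x in lborel. norm (h x * \<psi> x) \<le> norm (B * norm (h x))"
  proof (rule AE_I2)
    fix x
    have "norm (h x) * norm (\<psi> x) \<le> norm (h x) * B"
      by (intro mult_left_mono \<psi>(2)) auto
    also have "\<dots> \<le> norm (B * norm (h x))"
      by (simp add: mult.commute)
    finally show "norm (h x * \<psi> x) \<le> norm (B * norm (h x))"
      by (simp add: norm_mult)
  qed
qed

context
  fixes h :: "real \<Rightarrow> complex"
  assumes h: "integrable lborel h"
    and h0: "\<And>k::int. (LINT x|lborel. h x * cis (of_int k * x)) = 0"
begin

definition annihilated :: "(real \<Rightarrow> complex) \<Rightarrow> bool" where
  "annihilated \<psi> \<longleftrightarrow> continuous_on UNIV \<psi> \<and> (\<exists>B. \<forall>x. norm (\<psi> x) \<le> B) \<and>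
     (\<forall>k::int. (LINT x|lborel. h x * (\<psi> x * cis (of_int k * x))) = 0)"

lemma annihilated_integrable:
  assumes "annihilated \<psi>"
  shows "integrable lborel (\<lambda>x. h x * (\<psi> x * cis (of_int k * x)))"
proof -
  obtain B where B: "\<And>x. norm (\<psi> x) \<le> B" "continuous_on UNIV \<psi>"
    using assms by (auto simp: annihilated_def)
  show ?thesis
    by (rule integrable_mult_bounded_continuous[OF h, of _ B])
       (use B in \<open>auto intro!: continuous_intros simp: norm_mult\<close>)
qed

lemma annihilated_1: "annihilated (\<lambda>x. 1)"
  using h0 by (auto simp: annihilated_def)

lemma annihilated_add:
  assumes "annihilated \<phi>" "annihilated \<psi>"
  shows "annihilated (\<lambda>x. \<phi> x + \<psi> x)"
proof -
  obtain B B' where "\<And>x. norm (\<phi> x) \<le> B" "\<And>x. norm (\<psi> x) \<le> B'"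
    using assms by (auto simp: annihilated_def)
  hence "norm (\<phi> x + \<psi> x) \<le> B + B'" for x
    by (intro norm_triangle_le add_mono)
  moreover have "(LINT x|lborel. h x * ((\<phi> x + \<psi> x) * cis (of_int k * x))) = 0" for k
    using annihilated_integrable[OF assms(1), of k] annihilated_integrable[OF assms(2), of k] assms
    by (simp add: distrib_left distrib_right annihilated_def)
  ultimately show ?thesis
    using assms by (auto simp: annihilated_def intro!: continuous_intros exI[of _ "B + B'"])
qed

lemma annihilated_cmult:
  assumes "annihilated \<psi>"
  shows "annihilated (\<lambda>x. c * \<psi> x)"
proof -
  obtain B where "\<And>x. norm (\<psi> x) \<le> B"
    using assms by (auto simp: annihilated_def)
  hence "norm (c * \<psi> x) \<le> norm c * B" for x
    by (simp add: norm_mult mult_left_mono)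
  moreover have "(LINT x|lborel. h x * (c * \<psi> x * cis (of_int k * x))) = 0" for k
  proof -
    have "(LINT x|lborel. h x * (c * \<psi> x * cis (of_int k * x))) = (LINT x|lborel. c * (h x * (\<psi> x * cis (of_int k * x))))"
      by (simp add: mult_ac)
    thus ?thesis
      using assms by (simp add: annihilated_def)
  qed
  ultimately show ?thesis
    using assms by (auto simp: annihilated_def intro!: continuous_intros exI[of _ "norm c * B"])
qed

lemma annihilated_cis:
  assumes "annihilated \<psi>"
  shows "annihilated (\<lambda>x. cis (of_int m * x) * \<psi> x)"
proof -
  have "(LINT x|lborel. h x * (cis (of_int m * x) * \<psi> x * cis (of_int k * x))) = 0" for k
  proof -
    have "(LINT x|lborel. h x * (cis (of_int m * x) * \<psi> x * cis (of_int k * x)))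
        = (LINT x|lborel. h x * (\<psi> x * cis (of_int (m + k) * x)))"
      by (simp only: cis_mult[symmetric] distrib_right of_int_add) (simp only: mult_ac)
    thus ?thesis
      using assms by (metis annihilated_def)
  qed
  thus ?thesis
    using assms by (auto simp: annihilated_def norm_mult intro!: continuous_intros)
qed

text \<open>Quantifying over all multiples \<open>\<psi>\<close> makes the property multiplicative, so that no
  explicit trigonometric polynomial is needed.\<close>

lemma annihilated_polynomial:
  assumes "real_polynomial_function (P :: complex \<Rightarrow> real)" "annihilated \<psi>"
  shows "annihilated (\<lambda>x. of_real (P (cis x)) * \<psi> x)"
  using assms
proof (induction arbitrary: \<psi>)
  case (linear f)
  interpret bounded_linear f by fact
  \<comment> \<open>On the circle a real linear form equals
    \<open>cos x * f 1 + sin x * f \<i>\<close>, hence a combination of the frequencies 1 and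
    -1.\<close>
  have "of_real (f (cis x)) * \<psi> x =
      (of_real (f 1) / 2 + of_real (f \<i>) / (2 * \<i>)) * (cis (of_int 1 * x) * \<psi> x) +
      (of_real (f 1) / 2 - of_real (f \<i>) / (2 * \<i>)) * (cis (of_int (-1) * x) * \<psi> x)" for x
  proof -
    have "cis x = cos x *\<^sub>R 1 + sin x *\<^sub>R \<i>"
      by (simp add: complex_eq_iff)
    hence f: "f (cis x) = cos x * f 1 + sin x * f \<i>"
      by (simp add: add scaleR)
    have c: "of_real (cos x) = (cis x + cis (- x)) / 2" "of_real (sin x) = (cis x - cis (- x)) / (2 * \<i>)"
      by (auto simp: complex_eq_iff)
    show ?thesis
      unfolding f of_real_add of_real_mult c by (simp add: field_simps)
  qed
  thus ?case
    by (simp only:) (rule annihilated_add; rule annihilated_cmult; rule annihilated_cis; rule linear.prems)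
next
  case (const c)
  thus ?case by (intro annihilated_cmult)
next
  case (add f g)
  have "annihilated (\<lambda>x. of_real (f (cis x)) * \<psi> x + of_real (g (cis x)) * \<psi> x)"
    by (intro annihilated_add add)
  thus ?case by (simp add: distrib_right)
next
  case (mult f g)
  have "annihilated (\<lambda>x. of_real (f (cis x)) * (of_real (g (cis x)) * \<psi> x))"
    by (intro mult)
  thus ?case by (simp add: mult.assoc)
qed

text \<open>Stone-Weierstrass on the unit circle in the plane, where periodicity is built in. The
  error is at most the \<open>L\<^sub>1\<close> norm \<open>N\<close> of \<open>h\<close> times the
  uniform distance; \<open>N + 1\<close> in the denominator covers \<open>N = 0\<close>.\<close>

lemma annihilates_continuous:
  fixes \<Phi> :: "complex \<Rightarrow> real"
  assumes \<Phi>: "continuous_on UNIV \<Phi>"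
  shows "(LINT x|lborel. h x * of_real (\<Phi> (cis x))) = 0"
proof -
  define I where "I = (LINT x|lborel. h x * of_real (\<Phi> (cis x)))"
  define N where "N = (LINT x|lborel. norm (h x))"
  have N: "0 \<le> N" by (simp add: N_def)
  have "norm I \<le> 0 + e" if "0 < e" for e
  proof -
    have e': "0 < e / (N + 1)" using that N by simp
    obtain P where P: "real_polynomial_function P" "\<And>z. z \<in> sphere 0 1 \<Longrightarrow> \<bar>\<Phi> z - P z\<bar> < e / (N + 1)"
      using Stone_Weierstrass_real_polynomial_function[of "sphere 0 1" \<Phi>, OF _ _ e']
        continuous_on_subset[OF \<Phi>] by auto
    have ann: "annihilated (\<lambda>x. of_real (P (cis x)))"
      using annihilated_polynomial[OF P(1) annihilated_1] by simp
    have intP: "integrable lborel (\<lambda>x. h x * of_real (P (cis x)))" and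
      P0: "(LINT x|lborel. h x * of_real (P (cis x))) = 0"
      using annihilated_integrable[OF ann, of 0] ann by (auto simp: annihilated_def dest!: spec[of _ "0::int"])
    have "bounded (\<Phi> ` sphere 0 1)"
      by (intro compact_imp_bounded compact_continuous_image continuous_on_subset[OF \<Phi>]) auto
    then obtain B where B: "\<And>z. z \<in> sphere 0 1 \<Longrightarrow> norm (\<Phi> z) \<le> B"
      unfolding bounded_iff by blast
    have cont: "continuous_on UNIV (\<lambda>x. complex_of_real (\<Phi> (cis x)))"
      by (intro continuous_intros continuous_on_compose2[OF \<Phi>]) auto
    have int\<Phi>: "integrable lborel (\<lambda>x. h x * of_real (\<Phi> (cis x)))"
      by (rule integrable_mult_bounded_continuous[OF h cont, of B]) (use B in auto)
    have "norm I = norm (LINT x|lborel. h x * of_real (\<Phi> (cis x)) - h x * of_real (P (cis x)))"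
      using int\<Phi> intP P0 by (simp add: I_def)
    also have "\<dots> \<le> (LINT x|lborel. e / (N + 1) * norm (h x))"
    proof (rule Bochner_Integration.integral_norm_bound_integral)
      fix x
      have "norm (h x * of_real (\<Phi> (cis x)) - h x * of_real (P (cis x))) = norm (h x) * \<bar>\<Phi> (cis x) - P (cis x)\<bar>"
        by (metis norm_mult norm_of_real of_real_diff right_diff_distrib)
      also have "\<dots> \<le> norm (h x) * (e / (N + 1))"
        by (intro mult_left_mono less_imp_le[OF P(2)]) auto
      finally show "norm (h x * of_real (\<Phi> (cis x)) - h x * of_real (P (cis x))) \<le> e / (N + 1) * norm (h x)"
        by (simp add: mult.commute)
    qed (use int\<Phi> intP h in auto)
    also have "\<dots> = e / (N + 1) * N"
      by (simp add: N_def)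
    also have "\<dots> \<le> e"
      using N that by (simp add: field_simps)
    finally show ?thesis by simp
  qed
  hence "norm I \<le> 0" by (rule field_le_epsilon)
  thus ?thesis by (simp add: I_def)
qed

text \<open>The indicator of an arc is a pointwise limit of continuous functions of the distance to
  it. The bounds at \<open>- pi\<close> and \<open>pi\<close> are strict because \<open>cis\<close>
  identifies these points: away from them \<open>Arg\<close> recovers \<open>x\<close>, so the arc
  meets no points of the open interval other than those of \<open>{c..d}\<close>.\<close>

lemma integral_interval_eq_0:
  assumes supp: "\<And>x. x \<notin> {-pi<..<pi} \<Longrightarrow> h x = 0"
    and cd: "-pi < c" "d < pi"
  shows "(LINT x:{c..d}|lborel. h x) = 0"
proof (cases "c \<le> d")
  case True
  define K where "K = cis ` {c..d}"
  have K: "closed K" "K \<noteq> {}"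
    unfolding K_def using True
    by (auto intro!: compact_imp_closed compact_continuous_image continuous_intros)
  have mem: "cis x \<in> K \<longleftrightarrow> x \<in> {c..d}" if "x \<in> {-pi<..<pi}" for x
  proof
    assume "cis x \<in> K"
    then obtain y where y: "y \<in> {c..d}" "cis x = cis y" by (auto simp: K_def)
    have "Arg (cis x) = x" "Arg (cis y) = y"
      using that y(1) cd by (intro Arg_cis; simp)+
    thus "x \<in> {c..d}" using y by metis
  qed (auto simp: K_def)
  \<comment> \<open>\<open>\<Phi> n\<close> is 1 on the closed arc \<open>K\<close> and, for
    \<open>n > 0\<close>, vanishes at distance \<open>1 / n\<close> from it and beyond.\<close>
  define \<Phi> where "\<Phi> n z = max 0 (1 - real n * infdist z K)" for n z
  have \<Phi>: "0 \<le> \<Phi> n z" "\<Phi> n z \<le> 1" for n z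
    by (auto simp: \<Phi>_def infdist_nonneg)
  have cont: "continuous_on S (\<Phi> n)" for n S
    unfolding \<Phi>_def by (intro continuous_intros)
  have cont': "continuous_on UNIV (\<lambda>x. complex_of_real (\<Phi> n (cis x)))" for n
    by (intro continuous_intros continuous_on_compose2[OF cont[of UNIV]]) auto
  have lim: "(\<lambda>n. h x * of_real (\<Phi> n (cis x))) \<longlonglongrightarrow> indicator {c..d} x *\<^sub>R h x" for x
  proof (cases "x \<in> {-pi<..<pi}")
    case False
    thus ?thesis using supp by simp
  next
    case x: True
    show ?thesis
    proof (cases "x \<in> {c..d}")
      case True
      hence "infdist (cis x) K = 0" using mem[OF x] by auto
      thus ?thesis using True by (simp add: \<Phi>_def)
    next
      case False
      hence "infdist (cis x) K > 0"
        using mem[OF x] K infdist_pos_not_in_closed by blast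
      have "\<forall>\<^sub>F n in sequentially. h x * of_real (\<Phi> n (cis x)) = 0"
        using eventually_ge_at_top[of "nat \<lceil>1 / infdist (cis x) K\<rceil>"]
      proof eventually_elim
        case (elim n)
        hence "1 / infdist (cis x) K \<le> real n" by linarith
        hence "1 \<le> real n * infdist (cis x) K"
          using \<open>infdist (cis x) K > 0\<close> by (simp add: field_simps)
        thus ?case by (simp add: \<Phi>_def)
      qed
      thus ?thesis using False by (auto intro: tendsto_eventually)
    qed
  qed
  have [measurable]: "h \<in> borel_measurable lborel"
    using h by auto
  have "(\<lambda>n. (LINT x|lborel. h x * of_real (\<Phi> n (cis x)))) \<longlonglongrightarrow> (LINT x|lborel. indicator {c..d} x *\<^sub>R h x)"
  proof (rule integral_dominated_convergence[where w = "\<lambda>x. norm (h x)"])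
    show "(\<lambda>x. h x * of_real (\<Phi> n (cis x))) \<in> borel_measurable lborel" for n
      using integrable_mult_bounded_continuous[OF h cont', of n 1] \<Phi> by auto
    show "AE x in lborel. norm (h x * of_real (\<Phi> n (cis x))) \<le> norm (h x)" for n
      using \<Phi> by (auto simp: norm_mult intro!: mult_left_le)
  qed (use h lim in auto)
  moreover have "(LINT x|lborel. h x * of_real (\<Phi> n (cis x))) = 0" for n
    by (rule annihilates_continuous[OF cont])
  ultimately show ?thesis
    by (simp add: set_lebesgue_integral_def LIMSEQ_const_iff)
qed (simp add: set_lebesgue_integral_def)

text \<open>An integrable function whose integral over every Borel set vanishes is 0 almost
  everywhere. The sets are reached by Borel induction from intervals; the step to complements uses
  the coefficient with \<open>k = 0\<close>.\<close>

lemma AE_eq_0_open: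
  assumes supp: "\<And>x. x \<notin> {-pi<..<pi} \<Longrightarrow> h x = 0"
  shows "AE x in lborel. h x = 0"
proof (rule sigma_finite_measure.density_zero[OF lborel.sigma_finite_measure_axioms h])
  have ind: "integrable lborel (\<lambda>x. indicator A x *\<^sub>R h x)" if "A \<in> sets borel" for A
    using h that by (intro integrable_mult_indicator) auto
  have si: "set_integrable lborel A h" if "A \<in> sets borel" for A
    using ind[OF that] by (simp add: set_integrable_def)
  fix A :: "real set"
  assume "A \<in> sets lborel"
  hence "A \<in> sets borel" by simp
  thus "(LINT x:A|lborel. h x) = 0"
  proof (induction rule: borel_set_induct)
    case empty
    show ?case by (simp add: set_lebesgue_integral_def)
  next
    case (interval a b)
    \<comment> \<open>The interval is cut back strictly inside \<open>{-pi<..<pi}\<close>; nothing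
      is lost in the limit, since \<open>h\<close> vanishes outside this open interval.\<close>
    define c d where "c n = max a (- pi + 1 / real (Suc n))" and "d n = min b (pi - 1 / real (Suc n))" for n
    have "(\<lambda>n. LINT x|lborel. indicator {c n..d n} x *\<^sub>R h x) \<longlonglongrightarrow> (LINT x|lborel. indicator {a..b} x *\<^sub>R h x)"
    proof (rule integral_dominated_convergence[where w = "\<lambda>x. norm (h x)"])
      show "AE x in lborel. (\<lambda>n. indicator {c n..d n} x *\<^sub>R h x) \<longlonglongrightarrow> indicator {a..b} x *\<^sub>R h x"
      proof (rule AE_I2)
        fix x
        show "(\<lambda>n. indicator {c n..d n} x *\<^sub>R h x) \<longlonglongrightarrow> indicator {a..b} x *\<^sub>R h x"
        proof (cases "x \<in> {-pi<..<pi}")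
          case False
          thus ?thesis using supp by simp
        next
          case True
          have "(\<lambda>n. 1 / real (Suc n)) \<longlonglongrightarrow> 0"
            using lim_1_over_n LIMSEQ_Suc by blast
          moreover have "0 < min (x + pi) (pi - x)"
            using True by auto
          ultimately have "\<forall>\<^sub>F n in sequentially. 1 / real (Suc n) < min (x + pi) (pi - x)"
            by (rule order_tendstoD)
          hence "\<forall>\<^sub>F n in sequentially. indicator {c n..d n} x *\<^sub>R h x = indicator {a..b} x *\<^sub>R h x"
            by eventually_elim (auto simp: c_def d_def indicator_def)
          thus ?thesis by (rule tendsto_eventually)
        qed
      qed
      show "AE x in lborel. norm (indicator {c n..d n} x *\<^sub>R h x) \<le> norm (h x)" for n
        by (auto simp: indicator_def)
    qed (use h in auto)
    moreover have "(LINT x|lborel. indicator {c n..d n} x *\<^sub>R h x) = 0" for n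
    proof -
      have "0 < 1 / real (Suc n)" by simp
      hence "- pi < c n" "d n < pi" unfolding c_def d_def by linarith+
      thus ?thesis
        using integral_interval_eq_0[OF supp] by (simp add: set_lebesgue_integral_def)
    qed
    ultimately show ?case
      by (simp add: set_lebesgue_integral_def LIMSEQ_const_iff)
  next
    case (compl A)
    have "(LINT x:A \<union> -A|lborel. h x) = (LINT x:A|lborel. h x) + (LINT x:-A|lborel. h x)"
      using compl by (intro set_integral_Un si) auto
    moreover have "(LINT x:A \<union> -A|lborel. h x) = 0"
      using h0[of 0] by (simp add: set_lebesgue_integral_def)
    ultimately show ?case using compl by simp
  next
    case (union f)
    have "(LINT x:(\<Union>i. f i)|lborel. h x) = (\<Sum>i. LINT x:f i|lborel. h x)"
      using union si
      by (intro lebesgue_integral_countable_add) (auto simp: disjoint_family_on_def)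
    thus ?case using union by simp
  qed
qed

end

text \<open>The two end points form a null set, so \<open>h\<close> may be set to 0 there, and the
  case of open support applies.\<close>

lemma fourier_uniqueness:
  fixes h :: "real \<Rightarrow> complex"
  assumes "integrable lborel h" and supp: "\<And>x. x \<notin> {-pi..pi} \<Longrightarrow> h x = 0"
    and "\<And>k::int. (LINT x|lborel. h x * cis (of_int k * x)) = 0"
  shows "AE x in lborel. h x = 0"
proof -
  define g where "g x = (if x \<in> {-pi<..<pi} then h x else 0)" for x
  have g: "g = (\<lambda>x. indicator {-pi<..<pi} x *\<^sub>R h x)"
    by (auto simp: g_def)
  have int: "integrable lborel g"
    unfolding g using assms by (intro integrable_mult_indicator) auto
  have "AE x in lborel. x \<noteq> pi" "AE x in lborel. x \<noteq> -pi"
    by (rule AE_lborel_singleton)+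
  hence ae: "AE x in lborel. g x = h x"
    by eventually_elim (use supp in \<open>force simp: g_def\<close>)
  have "(LINT x|lborel. g x * cis (of_int k * x)) = 0" for k
  proof -
    have int1: "integrable lborel (\<lambda>x. g x * cis (of_int k * x))" "integrable lborel (\<lambda>x. h x * cis (of_int k * x))"
      by (rule integrable_mult_bounded_continuous[where B = 1];
          use int assms in \<open>auto intro!: continuous_intros\<close>)+
    have "(LINT x|lborel. g x * cis (of_int k * x)) = (LINT x|lborel. h x * cis (of_int k * x))"
      by (rule integral_cong_AE)
         (use int1 ae in \<open>auto dest!: borel_measurable_integrable\<close>)
    thus ?thesis using assms by simp
  qed
  hence "AE x in lborel. g x = 0"
    by (intro AE_eq_0_open int) (auto simp: g_def)
  thus ?thesis
    using ae by eventually_elim auto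
qed

section \<open>Dyadic shells and the Dirichlet kernel\<close>

definition shell :: "nat \<Rightarrow> real set" where
  "shell j = {x. pi / 2 ^ Suc j < \<bar>x\<bar> \<and> \<bar>x\<bar> \<le> pi / 2 ^ j}"

lemma shell_borel [measurable]: "shell j \<in> sets borel"
  unfolding shell_def by measurable

lemma disjoint_shell: "disjoint_family shell"
proof -
  have "shell i \<inter> shell j = {}" if "i < j" for i j
  proof -
    have "(2::real) ^ Suc i \<le> 2 ^ j"
      using that by (intro power_increasing) auto
    hence "pi / 2 ^ j \<le> pi / 2 ^ Suc i"
      by (intro divide_left_mono) auto
    thus ?thesis by (auto simp: shell_def)
  qed
  thus ?thesis
    unfolding disjoint_family_on_def by (metis inf_commute linorder_neqE_nat)
qed

lemma UN_shell: "(\<Union>j. shell j) = {-pi..pi} - {0}"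
proof (intro equalityI subsetI)
  fix x assume "x \<in> (\<Union>j. shell j)"
  then obtain j where j: "pi / 2 ^ Suc j < \<bar>x\<bar>" "\<bar>x\<bar> \<le> pi / 2 ^ j"
    by (auto simp: shell_def)
  have "pi / 2 ^ j \<le> pi / 1" by (intro divide_left_mono) auto
  moreover have "0 < pi / 2 ^ Suc j" by simp
  ultimately have "0 < \<bar>x\<bar>" "\<bar>x\<bar> \<le> pi" using j by linarith+
  thus "x \<in> {-pi..pi} - {0}" by auto
next
  fix x assume x: "x \<in> {-pi..pi} - {0}"
  define j where "j = (LEAST j. pi / 2 ^ Suc j < \<bar>x\<bar>)"
  obtain i where "pi / \<bar>x\<bar> < 2 ^ i"
    using real_arch_pow[of 2 "pi / \<bar>x\<bar>"] by auto
  also have "(2::real) ^ i \<le> 2 ^ Suc i" by simp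
  finally have "pi / 2 ^ Suc i < \<bar>x\<bar>"
    using x by (simp add: field_simps)
  hence "pi / 2 ^ Suc j < \<bar>x\<bar>"
    unfolding j_def by (rule LeastI)
  moreover have "\<bar>x\<bar> \<le> pi / 2 ^ j"
  proof (cases j)
    case 0
    thus ?thesis using x by auto
  next
    case (Suc i)
    hence "\<not> pi / 2 ^ Suc i < \<bar>x\<bar>"
      unfolding j_def by (intro not_less_Least) simp
    thus ?thesis using Suc by simp
  qed
  ultimately show "x \<in> (\<Union>j. shell j)" by (auto simp: shell_def)
qed

lemma in_shell:
  assumes "x \<in> {-pi..pi}" "x \<noteq> 0"
  obtains j where "x \<in> shell j"
proof -
  have "x \<in> (\<Union>j. shell j)" using assms by (simp add: UN_shell)
  thus ?thesis using that by auto
qed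

lemma emeasure_shell_le: "emeasure lborel (shell j) \<le> ennreal (2 * pi / 2 ^ j)"
proof -
  have "emeasure lborel (shell j) \<le> emeasure lborel {- (pi / 2 ^ j)..pi / 2 ^ j}"
    by (intro emeasure_mono) (auto simp: shell_def)
  also have "\<dots> = ennreal (2 * pi / 2 ^ j)" by simp
  finally show ?thesis .
qed

text \<open>From Taylor, \<open>sin t \<ge> t - t ^ 3 / 6\<close>, and
  \<open>t ^ 3 \<le> 4 * t\<close> on the range, which contains all half angles because
  \<open>pi < 4\<close>.\<close>

lemma sin_ge_third:
  assumes "0 \<le> t" "t \<le> 2"
  shows "t / 3 \<le> sin (t :: real)"
proof -
  have "(\<Sum>m<3. sin_coeff m * t ^ m) = t"
    by (simp add: sin_coeff_def numeral_eq_Suc)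
  hence "\<bar>sin t - t\<bar> \<le> 1 / 6 * \<bar>t\<bar> ^ 3"
    using Maclaurin_sin_bound[of t 3] by (simp add: fact_numeral)
  moreover have "\<bar>t\<bar> ^ 3 \<le> 4 * t"
  proof -
    have "t * t \<le> 2 * 2" using assms by (intro mult_mono) auto
    hence "t * t * t \<le> 4 * t" using assms by (intro mult_right_mono) auto
    thus ?thesis using assms by (simp add: power3_eq_cube)
  qed
  ultimately show ?thesis by linarith
qed

text \<open>The chord length \<open>2 * \<bar>sin (x / 2)\<bar>\<close> is at least
  \<open>\<bar>x\<bar> / 3\<close>; the 3 is absorbed by \<open>pi > 3\<close> in the lower radius
  of the shell.\<close>

lemma norm_1_minus_cis_ge:
  assumes "x \<in> shell j"
  shows "1 / 2 ^ Suc j \<le> norm (1 - cis x)"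
proof -
  have x: "x \<in> {-pi..pi}" using assms UN_shell by blast
  have "norm (1 - cis x) = 2 * \<bar>sin (x / 2)\<bar>"
    using dist_exp_i_1[of x] by (simp add: cis_conv_exp norm_minus_commute)
  also have "\<bar>sin (x / 2)\<bar> = \<bar>sin (\<bar>x\<bar> / 2)\<bar>"
    by (cases "0 \<le> x") auto
  also have "2 * (\<bar>x\<bar> / 2 / 3) \<le> 2 * \<bar>sin (\<bar>x\<bar> / 2)\<bar>"
    using sin_ge_third[of "\<bar>x\<bar> / 2"] x pi_less_4 by (auto simp: abs_le_iff)
  finally have "\<bar>x\<bar> / 3 \<le> norm (1 - cis x)" by simp
  moreover have "3 / 2 ^ Suc j \<le> pi / 2 ^ Suc j"
    using pi_gt3 by (intro divide_right_mono) auto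
  ultimately show ?thesis
    using assms by (simp add: shell_def)
qed

lemma norm_geometric_sum_le:
  fixes z :: complex
  assumes "norm z = 1"
  shows "norm (\<Sum>i\<le>m. z ^ i) \<le> real m + 1"
    and "1 / 2 ^ Suc j \<le> norm (1 - z) \<Longrightarrow> norm (\<Sum>i\<le>m. z ^ i) \<le> 4 * 2 ^ j"
proof -
  show "norm (\<Sum>i\<le>m. z ^ i) \<le> real m + 1"
    using sum_norm_bound[of "{..m}" "\<lambda>i. z ^ i" 1] assms by (simp add: norm_power add.commute)
  assume "1 / 2 ^ Suc j \<le> norm (1 - z)"
  hence "1 / 2 ^ Suc j * norm (\<Sum>i\<le>m. z ^ i) \<le> norm (1 - z) * norm (\<Sum>i\<le>m. z ^ i)"
    by (intro mult_right_mono) auto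
  also have "\<dots> = norm (1 - z ^ Suc m)"
    by (simp only: norm_mult[symmetric] sum_gp_basic)
  also have "\<dots> \<le> 2"
    using norm_triangle_ineq4[of 1 "z ^ Suc m"] assms by (simp add: norm_power norm_mult)
  finally show "norm (\<Sum>i\<le>m. z ^ i) \<le> 4 * 2 ^ j"
    by (simp add: field_simps)
qed

section \<open>Fourier coefficients against shell masses\<close>

lemma fourier_coeff_eq_integral:
  assumes "\<And>x. x \<notin> {-pi..pi} \<Longrightarrow> f x = 0"
  shows "fourier_coeff f k = of_real (1 / (2 * pi)) * (LINT x|lborel. f x * cis (- (of_int k * x)))"
proof -
  have "indicator {-pi..pi} x *\<^sub>R (f x * exp (- (\<i> * of_int k * complex_of_real x))) = f x * cis (- (of_int k * x))" for x
    using assms[of x] by (cases "x \<in> {-pi..pi}") (auto simp: cis_conv_exp mult.assoc)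
  thus ?thesis
    by (simp add: fourier_coeff_def set_lebesgue_integral_def)
qed

context
  fixes f :: "real \<Rightarrow> complex"
  assumes f: "integrable lborel f" and supp: "\<And>x. x \<notin> {-pi..pi} \<Longrightarrow> f x = 0"
begin

definition shell_mass :: "nat \<Rightarrow> real" where
  "shell_mass j = (LINT x:shell j|lborel. norm (f x))"

lemma f_borel [measurable]: "f \<in> borel_measurable borel"
  using f by simp

lemma shell_mass_nonneg: "0 \<le> shell_mass j"
  by (auto simp: shell_mass_def set_lebesgue_integral_def)

lemma shell_mass_eq: "ennreal (shell_mass j) = (\<integral>\<^sup>+x. indicator (shell j) x * ennreal (norm (f x)) \<partial>lborel)"
proof -
  have "integrable lborel (\<lambda>x. indicator (shell j) x *\<^sub>R norm (f x))"
    using f by (intro integrable_mult_indicator) auto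
  hence "ennreal (shell_mass j) = (\<integral>\<^sup>+x. ennreal (indicator (shell j) x *\<^sub>R norm (f x)) \<partial>lborel)"
    unfolding shell_mass_def set_lebesgue_integral_def by (subst nn_integral_eq_integral) auto
  also have "\<dots> = (\<integral>\<^sup>+x. indicator (shell j) x * ennreal (norm (f x)) \<partial>lborel)"
    by (intro nn_integral_cong) (auto simp: indicator_def)
  finally show ?thesis .
qed

text \<open>The power bound is applied to Lebesgue measure on one shell, of length at most
  \<open>2 * pi / 2 ^ j\<close>; the resulting power of 2 cancels the weight exactly, and the shells
  are disjoint.\<close>

lemma wsum_shell_mass_le:
  assumes p: "1 < p"
  shows "wsum p shell_mass \<le> ennreal (2 powr p * (2 * pi) powr (p - 1)) * Lp_norm_pow p f"
proof -
  define K where "K = 2 powr p * (2 * pi) powr (p - 1)"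
  have "ennreal (2 powr (real j * (p - 1)) * shell_mass j powr p) \<le>
      ennreal K * (\<integral>\<^sup>+x. indicator (shell j) x * ennreal (norm (f x) powr p) \<partial>lborel)" for j
  proof -
    have "ennreal (shell_mass j powr p) \<le> ennreal (2 powr p * (2 * pi / 2 ^ j) powr (p - 1)) *
        (\<integral>\<^sup>+x. ennreal (norm (f x) powr p) \<partial>restrict_space lborel (shell j))"
    proof (rule nn_integral_powr_ge[OF p])
      show "emeasure (restrict_space lborel (shell j)) (space (restrict_space lborel (shell j))) \<le> ennreal (2 * pi / 2 ^ j)"
        using emeasure_shell_le[of j] by (simp add: emeasure_restrict_space space_restrict_space)
      show "(\<lambda>x. norm (f x)) \<in> borel_measurable (restrict_space lborel (shell j))"
        by (intro measurable_restrict_space1) measurable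
      show "ennreal (shell_mass j) = (\<integral>\<^sup>+x. ennreal (norm (f x)) \<partial>restrict_space lborel (shell j))"
        by (simp add: shell_mass_eq nn_integral_restrict_space mult.commute)
    qed (auto simp: shell_mass_nonneg)
    also have "(\<integral>\<^sup>+x. ennreal (norm (f x) powr p) \<partial>restrict_space lborel (shell j)) =
        (\<integral>\<^sup>+x. indicator (shell j) x * ennreal (norm (f x) powr p) \<partial>lborel)"
      by (simp add: nn_integral_restrict_space mult.commute)
    finally have "ennreal (2 powr (real j * (p - 1))) * ennreal (shell_mass j powr p) \<le>
        ennreal (2 powr (real j * (p - 1))) * (ennreal (2 powr p * (2 * pi / 2 ^ j) powr (p - 1)) *
        (\<integral>\<^sup>+x. indicator (shell j) x * ennreal (norm (f x) powr p) \<partial>lborel))"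
      by (intro mult_left_mono) auto
    moreover have "ennreal (2 powr (real j * (p - 1))) * ennreal (2 powr p * (2 * pi / 2 ^ j) powr (p - 1)) = ennreal K"
      by (simp add: ennreal_mult'[symmetric] K_def powr_divide power2_powr)
    ultimately show ?thesis
      by (simp add: ennreal_mult mult.assoc[symmetric])
  qed
  hence "wsum p shell_mass \<le> (\<Sum>j. ennreal K * (\<integral>\<^sup>+x. indicator (shell j) x * ennreal (norm (f x) powr p) \<partial>lborel))"
    unfolding wsum_def by (intro suminf_le summableI)
  also have "\<dots> = ennreal K * (\<integral>\<^sup>+x. (\<Sum>j. indicator (shell j) x * ennreal (norm (f x) powr p)) \<partial>lborel)"
    by (subst nn_integral_suminf) auto
  also have "\<dots> \<le> ennreal K * Lp_norm_pow p f"
    unfolding Lp_norm_pow_def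
  proof (intro mult_left_mono nn_integral_mono)
    fix x
    have "(\<Sum>j. indicator (shell j) x) \<le> (indicator {-pi..pi} x :: ennreal)"
      using suminf_indicator[OF disjoint_shell, of x] UN_shell by (auto simp: indicator_def)
    thus "(\<Sum>j. indicator (shell j) x * ennreal (norm (f x) powr p)) \<le> indicator {-pi..pi} x * ennreal (norm (f x) powr p)"
      by (simp add: mult_right_mono)
  qed auto
  finally show ?thesis by (simp add: K_def)
qed

lemma integrable_mult_cis: "integrable lborel (\<lambda>x. f x * cis (t * x))"
  by (rule integrable_mult_bounded_continuous[OF f, of _ 1]) (auto intro!: continuous_intros)

lemma fourier_coeff_integral:
  "fourier_coeff f k = of_real (1 / (2 * pi)) * (LINT x|lborel. f x * cis (- (of_int k * x)))"
  by (rule fourier_coeff_eq_integral) (rule supp)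

lemma norm_fourier_coeff_le: "norm (fourier_coeff f k) \<le> (LINT x|lborel. norm (f x))"
proof -
  have "norm (LINT x|lborel. f x * cis (- (of_int k * x))) \<le> (LINT x|lborel. norm (f x))"
    by (rule order_trans[OF integral_norm_bound]) (simp add: norm_mult)
  hence "1 / (2 * pi) * norm (LINT x|lborel. f x * cis (- (of_int k * x))) \<le> 1 * (LINT x|lborel. norm (f x))"
    using pi_gt3 by (intro mult_mono) auto
  thus ?thesis
    by (simp add: fourier_coeff_integral norm_mult norm_divide)
qed

text \<open>De Moivre turns the characters into powers of one unimodular number, so the kernel of
  the partial sum is a geometric sum.\<close>

lemma psum_fourier_coeff:
  assumes "s = 1 \<or> s = - 1"
  shows "psum (fourier_coeff f) (s * int m) =
    of_real (1 / (2 * pi)) * (LINT x|lborel. f x * (\<Sum>i\<le>m. cis (- (of_int s * x)) ^ i))"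
proof -
  have int: "integrable lborel (\<lambda>x. f x * cis (- (of_int (s * int i) * x)))" for i
    using integrable_mult_cis[of "- of_int (s * int i)"] by simp
  have "(\<Sum>i\<le>m. LINT x|lborel. f x * cis (- (of_int (s * int i) * x))) =
      (LINT x|lborel. (\<Sum>i\<le>m. f x * cis (- (of_int (s * int i) * x))))"
    using int by (intro Bochner_Integration.integral_sum[symmetric])
  also have "\<dots> = (LINT x|lborel. f x * (\<Sum>i\<le>m. cis (- (of_int s * x)) ^ i))"
  proof -
    have "cis (- (of_int (s * int i) * x)) = cis (- (of_int s * x)) ^ i" for i x
    proof -
      have "- (of_int (s * int i) * x) = real i * (- (of_int s * x))" by simp
      thus ?thesis by (simp only: Complex.DeMoivre)
    qed
    thus ?thesis by (simp only: sum_distrib_left)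
  qed
  finally have eq: "(\<Sum>i\<le>m. LINT x|lborel. f x * cis (- (of_int (s * int i) * x))) =
      (LINT x|lborel. f x * (\<Sum>i\<le>m. cis (- (of_int s * x)) ^ i))" .
  show ?thesis
    by (simp only: psum_one_sided[OF assms] fourier_coeff_integral sum_distrib_left[symmetric] eq)
qed

text \<open>On the j-th shell the kernel is at most \<open>min (m + 1) (4 * 2 ^ j)\<close>. After
  division by \<open>m + 1\<close>, which exceeds \<open>2 ^ k\<close>, this becomes
  \<open>kap k j\<close>; the 4 is absorbed by the factor \<open>1 / (2 * pi)\<close>, so the
  estimate has constant 1.\<close>

lemma hat_a_le_shell_mass: "ennreal (hat_a (fourier_coeff f) k) \<le> (\<Sum>j. ennreal (kap k j * shell_mass j))"
proof (cases "(\<Sum>j. ennreal (kap k j * shell_mass j)) = top")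
  case False
  define S where "S = enn2real (\<Sum>j. ennreal (kap k j * shell_mass j))"
  have S: "0 \<le> S" "ennreal S = (\<Sum>j. ennreal (kap k j * shell_mass j))"
    using False by (auto simp: S_def less_top)
  have "hat_a (fourier_coeff f) k \<le> S"
  proof (rule hat_a_leI)
    fix m' :: int assume m': "2 ^ k \<le> \<bar>m'\<bar>" "\<bar>m'\<bar> < 2 ^ (k + 1)"
    define m where "m = nat \<bar>m'\<bar>"
    define s :: int where "s = (if 0 \<le> m' then 1 else - 1)"
    have s: "s = 1 \<or> s = - 1" "m' = s * int m" by (auto simp: s_def m_def)
    have "2 ^ k \<le> real_of_int \<bar>m'\<bar>"
      using m'(1) by (metis of_int_le_iff of_int_numeral of_int_power)
    hence m: "2 ^ k \<le> real m" by (simp add: m_def)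
    define D where "D x = (\<Sum>i\<le>m. cis (- (of_int s * x)) ^ i)" for x :: real
    define c where "c j = min (real m + 1) (4 * 2 ^ j)" for j
    have c0: "0 \<le> c j" for j by (simp add: c_def)
    have contD: "continuous_on UNIV D"
      unfolding D_def by (intro continuous_intros)
    have D_le: "norm (D x) \<le> real m + 1" for x
      unfolding D_def by (intro norm_geometric_sum_le) simp
    have intD: "integrable lborel (\<lambda>x. f x * D x)"
      by (rule integrable_mult_bounded_continuous[OF f contD D_le])
    have D_shell: "norm (D x) \<le> c j" if "x \<in> shell j" for x j
    proof -
      have "- (of_int s * x) \<in> shell j"
        using that s(1) by (auto simp: shell_def)
      hence "norm (D x) \<le> 4 * 2 ^ j"
        unfolding D_def by (intro norm_geometric_sum_le norm_1_minus_cis_ge) simp_all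
      thus ?thesis using D_le[of x] by (simp add: c_def)
    qed
    have "ennreal (norm (LINT x|lborel. f x * D x)) \<le> (\<integral>\<^sup>+x. ennreal (norm (f x * D x)) \<partial>lborel)"
      by (rule integral_norm_bound_ennreal[OF intD])
    also have "\<dots> \<le> (\<integral>\<^sup>+x. (\<Sum>j. ennreal (c j) * (indicator (shell j) x * ennreal (norm (f x)))) \<partial>lborel)"
    proof (rule nn_integral_mono_AE)
      have "AE x in lborel. x \<noteq> (0::real)" by (rule AE_lborel_singleton)
      thus "AE x in lborel. ennreal (norm (f x * D x)) \<le> (\<Sum>j. ennreal (c j) * (indicator (shell j) x * ennreal (norm (f x))))"
      proof eventually_elim
        case (elim x)
        show ?case
        proof (cases "x \<in> {-pi..pi}")
          case True
          then obtain j where j: "x \<in> shell j" using elim UN_shell by blast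
          have "norm (f x * D x) \<le> c j * norm (f x)"
            using mult_left_mono[OF D_shell[OF j] norm_ge_zero[of "f x"]] by (simp add: norm_mult mult.commute)
          hence "ennreal (norm (f x * D x)) \<le> ennreal (c j * norm (f x))" by (rule ennreal_leI)
          also have "\<dots> = ennreal (c j) * (indicator (shell j) x * ennreal (norm (f x)))"
            using j c0 by (simp add: ennreal_mult)
          also have "\<dots> \<le> (\<Sum>j. ennreal (c j) * (indicator (shell j) x * ennreal (norm (f x))))"
            by (rule ennreal_le_suminf)
          finally show ?thesis .
        qed (simp add: supp)
      qed
    qed
    also have "\<dots> = (\<Sum>j. ennreal (c j) * ennreal (shell_mass j))"
      by (subst nn_integral_suminf) (auto simp: nn_integral_cmult shell_mass_eq)
    finally have I: "ennreal (norm (LINT x|lborel. f x * D x)) \<le> (\<Sum>j. ennreal (c j) * ennreal (shell_mass j))" .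
    have c_le: "1 / (2 * pi) * c j \<le> (real m + 1) * kap k j" for j
    proof (cases "k \<le> j")
      case True
      have "1 / (2 * pi) * c j \<le> 1 * (real m + 1)"
        using pi_gt3 c0 by (intro mult_mono) (auto simp: c_def)
      thus ?thesis using True by (simp add: kap_def ge_one_powr_ge_zero)
    next
      case False
      have "1 / (2 * pi) * c j \<le> 1 / 4 * (4 * 2 ^ j)"
        using pi_gt3 c0 by (intro mult_mono) (auto simp: c_def)
      also have "\<dots> = 2 ^ k * kap k j"
        using False by (simp add: kap_def powr_diff powr_realpow)
      also have "\<dots> \<le> (real m + 1) * kap k j"
        using m by (intro mult_right_mono kap_nonneg) linarith
      finally show ?thesis .
    qed
    have "ennreal (norm (psum (fourier_coeff f) m')) = ennreal (1 / (2 * pi)) * ennreal (norm (LINT x|lborel. f x * D x))"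
      unfolding s(2) psum_fourier_coeff[OF s(1)] D_def[symmetric]
      by (simp add: norm_mult norm_divide ennreal_mult'[symmetric])
    also have "\<dots> \<le> ennreal (1 / (2 * pi)) * (\<Sum>j. ennreal (c j) * ennreal (shell_mass j))"
      by (intro mult_left_mono I) auto
    also have "\<dots> = (\<Sum>j. ennreal (1 / (2 * pi) * c j) * ennreal (shell_mass j))"
      using c0 by (simp only: ennreal_suminf_cmult[symmetric] mult.assoc[symmetric])
        (simp add: ennreal_mult'[symmetric])
    also have "\<dots> \<le> (\<Sum>j. ennreal ((real m + 1) * kap k j) * ennreal (shell_mass j))"
      by (intro suminf_le summableI mult_right_mono ennreal_leI c_le) auto
    also have "\<dots> = ennreal (real m + 1) * ennreal S"
    proof -
      have "ennreal (t * kap k j) * ennreal (shell_mass j) = ennreal t * ennreal (kap k j * shell_mass j)" if "0 \<le> t" for t j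
        using that by (simp add: ennreal_mult shell_mass_nonneg kap_nonneg mult.assoc)
      thus ?thesis by (simp only: S(2) ennreal_suminf_cmult)
    qed
    finally have "norm (psum (fourier_coeff f) m') \<le> (real m + 1) * S"
      using S(1) by (subst (asm) ennreal_mult'[symmetric], simp, subst (asm) ennreal_le_iff) auto
    moreover have "real_of_int \<bar>m'\<bar> = real m" by (simp add: m_def)
    ultimately show "norm (psum (fourier_coeff f) m') / (real_of_int \<bar>m'\<bar> + 1) \<le> S"
      by (simp add: divide_le_eq add_nonneg_pos mult.commute)
  qed
  thus ?thesis unfolding S(2)[symmetric] by (rule ennreal_leI)
qed simp

end

section \<open>Pointwise bounds for the function\<close>

text \<open>A single term of the finite weighted sum already forces geometric decay of
  \<open>G n\<close>, with ratio \<open>2 powr (- ((p - 1) / p)) < 1\<close>.\<close>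

lemma wsum_finite_imp_summable:
  assumes p: "1 < p" and G: "\<And>n. 0 \<le> G n" and fin: "wsum p G \<noteq> top"
  shows "summable G"
proof -
  define W where "W = enn2real (wsum p G)"
  define r :: real where "r = 2 powr (- ((p - 1) / p))"
  have r: "0 < r" "r < 1"
    using p powr_less_mono[of "- ((p - 1) / p)" 0 2] by (auto simp: r_def)
  have "G n \<le> W powr (1 / p) * r ^ n" for n
  proof -
    have "ennreal (2 powr (real n * (p - 1)) * G n powr p) \<le> wsum p G"
      unfolding wsum_def by (rule ennreal_le_suminf)
    also have "\<dots> = ennreal W"
      using fin by (simp add: W_def less_top)
    finally have "2 powr (real n * (p - 1)) * G n powr p \<le> W"
      by (simp add: W_def)
    hence "(2 powr (real n * (p - 1)) * G n powr p) powr (1 / p) \<le> W powr (1 / p)"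
      using p by (intro powr_mono2) auto
    moreover have "(2 powr (real n * (p - 1)) * G n powr p) powr (1 / p) = 2 powr (real n * ((p - 1) / p)) * G n"
      using p G by (simp add: powr_mult powr_powr)
    ultimately have "2 powr (real n * ((p - 1) / p)) * G n \<le> W powr (1 / p)" by simp
    moreover have "r ^ n = 1 / 2 powr (real n * ((p - 1) / p))"
    proof -
      have "r ^ n = r powr real n" using r by (simp add: powr_realpow)
      also have "\<dots> = 2 powr (- (real n * ((p - 1) / p)))"
        by (simp add: r_def powr_powr mult.commute)
      also have "\<dots> = 1 / 2 powr (real n * ((p - 1) / p))"
        by (rule powr_minus_divide)
      finally show ?thesis .
    qed
    ultimately show ?thesis
      by (simp add: pos_le_divide_eq mult.commute)
  qed
  hence "norm (G n) \<le> W powr (1 / p) * r ^ n" for n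
    using G[of n] by (metis abs_of_nonneg real_norm_def)
  moreover have "summable (\<lambda>n. W powr (1 / p) * r ^ n)"
    using r by (intro summable_mult summable_geometric) simp
  ultimately show ?thesis
    by (metis summable_comparison_test')
qed

lemma suminf_shell:
  fixes u :: "nat \<Rightarrow> 'a :: {t2_space, topological_comm_monoid_add, semiring_1}"
  assumes "x \<in> shell j"
  shows "(\<Sum>i. indicator (shell i) x * u i) = u j"
proof -
  have "x \<notin> shell i" if "i \<noteq> j" for i
    using disjoint_shell assms that by (auto simp: disjoint_family_on_def)
  hence "(\<lambda>i. indicator (shell i) x * u i) = (\<lambda>i. if i = j then u i else 0)"
    using assms by (auto simp: indicator_def)
  thus ?thesis
    using sums_single[of j u] by (simp add: sums_iff)
qed

definition circle_exp :: "int \<Rightarrow> real \<Rightarrow> complex" where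
  "circle_exp m x = indicator {-pi..pi} x *\<^sub>R cis (of_int m * x)"

lemma integrable_circle_exp [simp]: "integrable lborel (circle_exp m)"
proof -
  have "circle_exp m = (\<lambda>x. indicator {-pi..pi} x *\<^sub>R cis (of_int m * x))"
    by (simp add: circle_exp_def fun_eq_iff)
  moreover have "set_integrable lborel {-pi..pi} (\<lambda>x. cis (of_int m * x))"
    by (rule borel_integrable_atLeastAtMost') (auto intro!: continuous_intros)
  ultimately show ?thesis by (simp add: set_integrable_def)
qed

lemma integral_circle_exp:
  "(LINT x|lborel. circle_exp m x) = (if m = 0 then of_real (2 * pi) else 0)"
proof (cases "m = 0")
  case True
  thus ?thesis by (simp add: circle_exp_def scaleR_conv_of_real)
next
  case False
  define F where "F x = cis (of_int m * x) / (\<i> * of_int m)" for x :: real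
  have "(LINT x|lborel. indicator {-pi..pi} x *\<^sub>R cis (of_int m * x)) = F pi - F (- pi)"
  proof (rule integral_FTC_atLeastAtMost)
    fix x :: real
    have "((\<lambda>x. cis (of_int m * x)) has_derivative (\<lambda>t. (of_int m * t) *\<^sub>R (\<i> * cis (of_int m * x)))) (at x within {-pi..pi})"
      by (auto intro!: derivative_eq_intros)
    hence "((\<lambda>x. cis (of_int m * x)) has_vector_derivative \<i> * of_int m * cis (of_int m * x)) (at x within {-pi..pi})"
      by (simp add: has_vector_derivative_def scaleR_conv_of_real mult_ac)
    hence "(F has_vector_derivative (\<i> * of_int m * cis (of_int m * x)) / (\<i> * of_int m)) (at x within {-pi..pi})"
      unfolding F_def by (rule has_vector_derivative_divide)
    thus "(F has_vector_derivative cis (of_int m * x)) (at x within {-pi..pi})"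
      using False by simp
  qed (auto intro!: continuous_intros)
  moreover have "cis (of_int m * pi) = cis (of_int m * (- pi))"
  proof -
    have "cis (of_int m * pi) = cis (of_int m * (- pi)) * cis (2 * pi * of_int m)"
      unfolding cis_mult by (simp add: algebra_simps)
    thus ?thesis by simp
  qed
  ultimately show ?thesis
    using False by (simp add: circle_exp_def F_def)
qed

text \<open>The factor 15 is \<open>7 + 7 + 1\<close>: one bound for each half of the symmetric
  partial sum, and one for \<open>a 0\<close>. \<open>W\<close> serves twice, as the pointwise bound
  and as the dominating function that lets the coefficients pass to the limit.\<close>

lemma AE_norm_le_majorant:
  fixes f :: "real \<Rightarrow> complex"
  defines "a \<equiv> fourier_coeff f"
  assumes f: "integrable lborel f" and supp: "\<And>x. x \<notin> {-pi..pi} \<Longrightarrow> f x = 0"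
    and c: "0 \<le> c" and G: "\<And>n. 0 \<le> G n" "summable G"
    and b_le: "\<And>s n k. s = 1 \<or> s = - 1 \<Longrightarrow> k \<in> {2 ^ n div 2..<2 ^ n} \<Longrightarrow> norm (a (s * int k)) \<le> c * G n"
    and var_le: "\<And>s n. s = 1 \<or> s = - 1 \<Longrightarrow>
      (\<Sum>k\<in>{2 ^ n div 2..<2 ^ n}. norm (a (s * int k) - a (s * int (Suc k)))) \<le> c * G n"
    and W: "integrable lborel W" "\<And>x. 0 \<le> W x"
      "\<And>x j. x \<in> shell j \<Longrightarrow> 15 * (2 ^ j * (c * (\<Sum>n. kap j n * G n))) \<le> W x"
  shows "AE x in lborel. norm (f x) \<le> W x"
proof -
  define T where "T s N x = (\<Sum>k<N. a (s * int k) * cis (of_int s * x) ^ k)" for s :: int and N and x :: real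
  \<comment> \<open>Both halves \<open>T 1\<close> and \<open>T (- 1)\<close> contain the term with
    index 0, so one copy of \<open>a 0\<close> is removed.\<close>
  define S where "S N x = indicator {-pi..pi} x *\<^sub>R (T 1 N x + T (- 1) N x - a 0)" for N x
  define g where "g x = lim (\<lambda>N. S N x)" for x
  have z: "norm (cis (of_int s * x)) = 1" for s :: int and x :: real by simp
  have T_bound: "norm (T s N x) \<le> 7 * (2 ^ j * (c * (\<Sum>n. kap j n * G n)))"
    if s: "s = 1 \<or> s = - 1" and x: "x \<in> shell j" for s N x j
  proof -
    have "of_int s * x \<in> shell j" using s x by (auto simp: shell_def)
    thus ?thesis unfolding T_def
      by (intro norm_power_sum_le[where b = "\<lambda>k. a (s * int k)"] G c b_le[OF s] var_le[OF s] z norm_1_minus_cis_ge) auto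
  qed
  have T_conv: "convergent (\<lambda>N. T s N x)"
    if s: "s = 1 \<or> s = - 1" and x: "x \<in> shell j" for s x j
  proof -
    have "of_int s * x \<in> shell j" using s x by (auto simp: shell_def)
    hence "1 / 2 ^ Suc j \<le> norm (1 - cis (of_int s * x))" by (rule norm_1_minus_cis_ge)
    moreover have "(0::real) < 1 / 2 ^ Suc j" by simp
    ultimately have "cis (of_int s * x) \<noteq> 1"
      by (metis diff_self norm_zero not_le)
    note ne = this
    have "summable (\<lambda>k. a (s * int k) * cis (of_int s * x) ^ k)"
      by (rule power_series_summable[where b = "\<lambda>k. a (s * int k)" and G = G and c = c])
         (rule G c z ne b_le[OF s] var_le[OF s] | assumption)+
    thus ?thesis unfolding T_def summable_iff_convergent .
  qed
  have S_bound: "norm (S N x) \<le> W x" if nz: "x \<noteq> 0" for N x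
  proof (cases "x \<in> {-pi..pi}")
    case True
    then obtain j where j: "x \<in> shell j" using nz by (rule in_shell)
    define E where "E = (\<Sum>n. kap j n * G n)"
    have "norm (a 0) \<le> c * G 0" using b_le[of 1 0 0] by simp
    also have "\<dots> \<le> c * (2 ^ j * E)"
    proof (intro mult_left_mono c)
      have "kap j 0 * G 0 \<le> E"
        using sum_kap_le[of G "{0}" j, OF G] by (simp add: E_def)
      moreover have "kap j 0 = 1 / 2 ^ j"
        by (simp add: kap_def powr_minus_divide powr_realpow)
      ultimately show "G 0 \<le> 2 ^ j * E" by (simp add: field_simps)
    qed
    finally have "norm (a 0) \<le> 2 ^ j * (c * E)" by (simp add: mult_ac)
    moreover have "norm (T 1 N x) \<le> 7 * (2 ^ j * (c * E))" "norm (T (- 1) N x) \<le> 7 * (2 ^ j * (c * E))"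
      unfolding E_def by (intro T_bound j; simp)+
    moreover have "norm (S N x) \<le> norm (T 1 N x) + norm (T (- 1) N x) + norm (a 0)"
      using True norm_triangle_ineq4[of "T 1 N x + T (- 1) N x" "a 0"] norm_triangle_ineq[of "T 1 N x" "T (- 1) N x"]
      by (simp add: S_def)
    moreover have "15 * (2 ^ j * (c * E)) \<le> W x"
      unfolding E_def by (rule W(3)[OF j])
    ultimately show ?thesis by linarith
  qed (simp add: S_def W)
  have S_lim: "(\<lambda>N. S N x) \<longlonglongrightarrow> g x" if nz: "x \<noteq> 0" for x
  proof (cases "x \<in> {-pi..pi}")
    case True
    then obtain j where j: "x \<in> shell j" using nz by (rule in_shell)
    have "(\<lambda>N. S N x) = (\<lambda>N. T 1 N x + T (- 1) N x - a 0)"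
      using True by (simp add: S_def)
    hence "convergent (\<lambda>N. S N x)"
      using T_conv[OF _ j, of 1] T_conv[OF _ j, of "- 1"]
      by (simp add: convergent_diff convergent_add convergent_const)
    thus ?thesis by (simp add: g_def convergent_LIMSEQ_iff)
  qed (simp add: g_def S_def)
  have ne: "AE x in lborel. x \<noteq> (0::real)" by (rule AE_lborel_singleton)
  have S_meas [measurable]: "S N \<in> borel_measurable lborel" for N
  proof -
    have "continuous_on UNIV (\<lambda>x. T 1 N x + T (- 1) N x - a 0)"
      unfolding T_def by (intro continuous_intros)
    hence "(\<lambda>x. T 1 N x + T (- 1) N x - a 0) \<in> borel_measurable borel"
      by (rule borel_measurable_continuous_onI)
    thus ?thesis unfolding S_def by simp
  qed
  have g_meas [measurable]: "g \<in> borel_measurable lborel"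
    unfolding g_def by (rule borel_measurable_lim_metric) simp
  have g_int: "integrable lborel g"
    by (rule integrable_dominated_convergence[where s = S and w = W])
       (use W ne S_lim S_bound in \<open>auto elim!: eventually_mono\<close>)
  have g_bound: "AE x in lborel. norm (g x) \<le> W x"
    using ne
  proof eventually_elim
    case (elim x)
    show ?case
      by (rule LIMSEQ_le_const2[OF tendsto_norm[OF S_lim[OF elim]]]) (use S_bound[OF elim] in auto)
  qed
  \<comment> \<open>By orthogonality the k-th coefficient of a partial sum is already exact once
    \<open>N\<close> exceeds \<bar>k\<bar>. For \<open>k = 0\<close> both halves contribute
    \<open>a 0\<close>, and the subtracted copy corrects this.\<close>
  have coeff_S: "(LINT x|lborel. S N x * cis (of_int (- k) * x)) = of_real (2 * pi) * a k" if "nat \<bar>k\<bar> < N" for N and k :: int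
  proof -
    have T_mult: "indicator {-pi..pi} x *\<^sub>R (T s N x * cis (of_int (- k) * x)) = (\<Sum>j<N. a (s * int j) * circle_exp (s * int j - k) x)" for s x
      unfolding T_def circle_exp_def Complex.DeMoivre sum_distrib_right scaleR_sum_right
      by (intro sum.cong refl) (simp add: cis_mult mult.assoc algebra_simps)
    have eq: "S N x * cis (of_int (- k) * x) = (\<Sum>j<N. a (1 * int j) * circle_exp (1 * int j - k) x) +
        (\<Sum>j<N. a (- 1 * int j) * circle_exp (- 1 * int j - k) x) - a 0 * circle_exp (- k) x" for x
      unfolding T_mult[symmetric] by (simp add: S_def circle_exp_def algebra_simps)
    have "(LINT x|lborel. S N x * cis (of_int (- k) * x)) =
        (\<Sum>j<N. a (1 * int j) * (if 1 * int j - k = 0 then of_real (2 * pi) else 0)) +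
        (\<Sum>j<N. a (- 1 * int j) * (if - 1 * int j - k = 0 then of_real (2 * pi) else 0)) -
        a 0 * (if - k = 0 then of_real (2 * pi) else 0)"
      unfolding eq integral_circle_exp[symmetric] by simp
    also have "(\<Sum>j<N. a (1 * int j) * (if 1 * int j - k = 0 then of_real (2 * pi) else 0)) =
        (\<Sum>j<N. if j = nat k then (if 0 \<le> k then a k * of_real (2 * pi) else 0) else 0)"
      by (rule sum.cong) auto
    also have "\<dots> = (if 0 \<le> k then a k * of_real (2 * pi) else 0)"
      using that by (subst sum.delta) auto
    also have "(\<Sum>j<N. a (- 1 * int j) * (if - 1 * int j - k = 0 then of_real (2 * pi) else 0)) =
        (\<Sum>j<N. if j = nat (- k) then (if k \<le> 0 then a k * of_real (2 * pi) else 0) else 0)"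
      by (rule sum.cong) auto
    also have "\<dots> = (if k \<le> 0 then a k * of_real (2 * pi) else 0)"
      using that by (subst sum.delta) auto
    finally show ?thesis by (auto simp: mult.commute)
  qed
  have coeff_g: "(LINT x|lborel. g x * cis (of_int (- k) * x)) = of_real (2 * pi) * a k" for k :: int
  proof -
    have "(\<lambda>N. LINT x|lborel. S N x * cis (of_int (- k) * x)) \<longlonglongrightarrow> (LINT x|lborel. g x * cis (of_int (- k) * x))"
    proof (rule integral_dominated_convergence[where w = W])
      have [measurable]: "(\<lambda>x::real. cis (of_int (- k) * x)) \<in> borel_measurable borel"
        by (intro borel_measurable_continuous_onI continuous_intros)
      show "(\<lambda>x. g x * cis (of_int (- k) * x)) \<in> borel_measurable lborel"
        "\<And>N. (\<lambda>x. S N x * cis (of_int (- k) * x)) \<in> borel_measurable lborel"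
        using g_meas S_meas by measurable
      show "AE x in lborel. (\<lambda>N. S N x * cis (of_int (- k) * x)) \<longlonglongrightarrow> g x * cis (of_int (- k) * x)"
        using ne by eventually_elim (intro tendsto_intros S_lim)
      show "AE x in lborel. norm (S N x * cis (of_int (- k) * x)) \<le> W x" for N
        using ne by eventually_elim (simp add: norm_mult S_bound)
    qed (rule W)
    moreover have "(\<lambda>N. LINT x|lborel. S N x * cis (of_int (- k) * x)) \<longlonglongrightarrow> of_real (2 * pi) * a k"
    proof (rule tendsto_eventually)
      show "\<forall>\<^sub>F N in sequentially. (LINT x|lborel. S N x * cis (of_int (- k) * x)) = of_real (2 * pi) * a k"
        using eventually_gt_at_top[of "nat \<bar>k\<bar>"] by eventually_elim (rule coeff_S)
    qed
    ultimately show ?thesis by (rule LIMSEQ_unique)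
  qed
  have "AE x in lborel. f x - g x = 0"
  proof (rule fourier_uniqueness)
    show "integrable lborel (\<lambda>x. f x - g x)" using f g_int by simp
    show "f x - g x = 0" if "x \<notin> {-pi..pi}" for x
      using that supp[OF that] by (simp add: g_def S_def)
    fix k :: int
    have int_cis: "integrable lborel (\<lambda>x. h x * cis (of_int k * x))" if "integrable lborel h" for h
      by (rule integrable_mult_bounded_continuous[OF that, of _ 1]) (auto intro!: continuous_intros)
    have "fourier_coeff f (- k) = of_real (1 / (2 * pi)) * (LINT x|lborel. f x * cis (- (of_int (- k) * x)))"
      by (rule fourier_coeff_eq_integral) (rule supp)
    hence "(LINT x|lborel. f x * cis (of_int k * x)) = of_real (2 * pi) * a (- k)"
      by (simp add: a_def)
    moreover have "(LINT x|lborel. g x * cis (of_int k * x)) = of_real (2 * pi) * a (- k)"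
      using coeff_g[of "- k"] by simp
    ultimately show "(LINT x|lborel. (f x - g x) * cis (of_int k * x)) = 0"
      using int_cis[OF f] int_cis[OF g_int] by (simp add: left_diff_distrib)
  qed
  thus ?thesis
    using g_bound by eventually_elim simp
qed


text \<open>The step function with value \<open>u j\<close> on the j-th shell. Its integrability
  follows from that of its p-th power through \<open>W \<le> 1 + W powr p\<close>, the interval
  having finite length.\<close>

lemma shell_majorant:
  fixes u :: "nat \<Rightarrow> real"
  assumes p: "1 < p" and u: "\<And>j. 0 \<le> u j"
    and fin: "(\<Sum>j. ennreal (2 * pi / 2 ^ j * u j powr p)) \<noteq> top"
  obtains W where "integrable lborel W" "\<And>x. 0 \<le> W x" "\<And>x j. x \<in> shell j \<Longrightarrow> u j = W x"
    "(\<integral>\<^sup>+x. ennreal (W x powr p) \<partial>lborel) \<le> (\<Sum>j. ennreal (2 * pi / 2 ^ j * u j powr p))"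
proof
  define W where "W x = (\<Sum>j. indicator (shell j) x * u j)" for x
  show W_shell: "u j = W x" if "x \<in> shell j" for x j
    using that by (simp add: W_def suminf_shell)
  have W_outside: "W x = 0" if "x \<notin> (\<Union>j. shell j)" for x
    using that by (simp add: W_def indicator_def)
  show W_nonneg: "0 \<le> W x" for x
  proof (cases "x \<in> (\<Union>j. shell j)")
    case True
    then obtain j where "x \<in> shell j" by auto
    thus ?thesis using W_shell[of x j] u[of j] by simp
  qed (simp add: W_outside)
  have [measurable]: "W \<in> borel_measurable borel"
    unfolding W_def by measurable
  have "ennreal (W x powr p) = (\<Sum>j. indicator (shell j) x * ennreal (u j powr p))" for x
  proof (cases "x \<in> (\<Union>j. shell j)")
    case True
    then obtain j where j: "x \<in> shell j" by auto
    thus ?thesis using W_shell[OF j] by (simp add: suminf_shell)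
  next
    case False
    thus ?thesis using W_outside[OF False] by (simp add: indicator_def)
  qed
  hence "(\<integral>\<^sup>+x. ennreal (W x powr p) \<partial>lborel) = (\<integral>\<^sup>+x. (\<Sum>j. indicator (shell j) x * ennreal (u j powr p)) \<partial>lborel)"
    by simp
  also have "\<dots> = (\<Sum>j. emeasure lborel (shell j) * ennreal (u j powr p))"
    by (subst nn_integral_suminf) (auto simp: nn_integral_multc)
  also have "\<dots> \<le> (\<Sum>j. ennreal (2 * pi / 2 ^ j) * ennreal (u j powr p))"
    by (intro suminf_le summableI mult_right_mono emeasure_shell_le) auto
  also have "\<dots> = (\<Sum>j. ennreal (2 * pi / 2 ^ j * u j powr p))"
    by (simp add: ennreal_mult''[symmetric])
  finally show Wp: "(\<integral>\<^sup>+x. ennreal (W x powr p) \<partial>lborel) \<le> (\<Sum>j. ennreal (2 * pi / 2 ^ j * u j powr p))" .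
  show "integrable lborel W"
  proof (rule integrableI_nonneg)
    have "(\<integral>\<^sup>+x. ennreal (W x) \<partial>lborel) \<le> (\<integral>\<^sup>+x. indicator {-pi..pi} x + ennreal (W x powr p) \<partial>lborel)"
    proof (rule nn_integral_mono)
      fix x
      show "ennreal (W x) \<le> indicator {-pi..pi} x + ennreal (W x powr p)"
      proof (cases "x \<in> (\<Union>j. shell j)")
        case True
        hence "x \<in> {-pi..pi}" unfolding UN_shell by simp
        moreover have "W x \<le> 1 + W x powr p"
        proof (cases "W x \<le> 1")
          case False
          hence "W x powr 1 \<le> W x powr p" using p by (intro powr_mono) auto
          thus ?thesis using False by simp
        qed (simp add: add_increasing2)
        ultimately show ?thesis
          using ennreal_leI[of "W x" "1 + W x powr p"] by simp
      next
        case False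
        thus ?thesis using W_outside[OF False] by simp
      qed
    qed
    also have "\<dots> = emeasure lborel {-pi..pi} + (\<integral>\<^sup>+x. ennreal (W x powr p) \<partial>lborel)"
      by (subst nn_integral_add) auto
    also have "\<dots> < \<infinity>"
    proof -
      have "(\<integral>\<^sup>+x. ennreal (W x powr p) \<partial>lborel) < top"
        using Wp fin by (metis less_top order_le_less_trans)
      thus ?thesis by simp
    qed
    finally show "(\<integral>\<^sup>+x. ennreal (W x) \<partial>lborel) < \<infinity>" .
  qed (use W_nonneg in auto)
qed

section \<open>The two inequalities between norm and coefficient sum\<close>

lemma Jseq_le_Lp:
  assumes p: "1 < p" and C: "0 < C"
  obtains M where "0 < M"
    "\<And>f. integrable lborel f \<Longrightarrow> (\<And>x. x \<notin> {-pi..pi} \<Longrightarrow> f x = 0) \<Longrightarrow> GM_bar_with C (fourier_coeff f) \<Longrightarrow>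
       Jseq p (fourier_coeff f) \<le> ennreal M * Lp_norm_pow p f"
proof -
  obtain M where M: "0 < M" "\<And>u v. (\<And>n. 0 \<le> u n) \<Longrightarrow> (\<And>n. 0 \<le> v n) \<Longrightarrow>
       (\<And>n. ennreal (v n) \<le> ennreal 1 * (\<Sum>j. ennreal (kap n j * u j))) \<Longrightarrow>
       wsum p v \<le> ennreal M * wsum p u"
    using hardy_kap[OF p zero_less_one] by blast
  define K1 where "K1 = 2 powr \<bar>p - 2\<bar> * (3 + 3 * C) powr p"
  define K2 where "K2 = 2 powr p * (2 * pi) powr (p - 1)"
  have K: "0 < K1" "0 < K2" using C by (auto simp: K1_def K2_def)
  \<comment> \<open>\<open>M\<close> occurs twice, for the passage from \<open>hat_a\<close> to
    \<open>gm_bound\<close> and for that from shell masses to \<open>hat_a\<close>;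
    \<open>K1\<close> bounds coefficients by \<open>gm_bound\<close>, \<open>K2\<close> shell masses
    by the norm.\<close>
  show ?thesis
  proof (rule that[of "K1 * (M * (M * K2))"])
    show "0 < K1 * (M * (M * K2))" using K M by simp
    fix f :: "real \<Rightarrow> complex"
    assume f: "integrable lborel f" and supp: "\<And>x. x \<notin> {-pi..pi} \<Longrightarrow> f x = 0"
      and GM: "GM_bar_with C (fourier_coeff f)"
    note bnd = norm_fourier_coeff_le[OF f supp]
    have "Jseq p (fourier_coeff f) \<le> ennreal K1 * wsum p (gm_bound (fourier_coeff f))"
      unfolding K1_def using C
      by (intro Jseq_le_wsum p gm_bound_nonneg[OF bnd] norm_le_gm_bound[OF bnd GM]) auto
    also have "wsum p (gm_bound (fourier_coeff f)) \<le> ennreal M * wsum p (hat_a (fourier_coeff f))"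
      using gm_bound_le_suminf[OF bnd] by (intro M hat_a_nonneg gm_bound_nonneg[OF bnd]) auto
    also have "wsum p (hat_a (fourier_coeff f)) \<le> ennreal M * wsum p (shell_mass f)"
      using hat_a_le_shell_mass[OF f supp] by (intro M hat_a_nonneg shell_mass_nonneg[OF f supp]) auto
    also have "wsum p (shell_mass f) \<le> ennreal K2 * Lp_norm_pow p f"
      unfolding K2_def by (rule wsum_shell_mass_le[OF f supp p])
    finally have "Jseq p (fourier_coeff f) \<le> ennreal K1 * (ennreal M * (ennreal M * (ennreal K2 * Lp_norm_pow p f)))"
      by (simp add: mult_left_mono)
    thus "Jseq p (fourier_coeff f) \<le> ennreal (K1 * (M * (M * K2))) * Lp_norm_pow p f"
      using K M by (simp add: ennreal_mult mult.assoc)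
  qed
qed

text \<open>Three Hardy steps lead from block means to \<open>hat_a\<close>, to \<open>G\<close> and
  to the tail averages \<open>E\<close>, which give the height of the majorant on each shell.
  \<open>M\<close> is obtained before \<open>f\<close>, so it depends only on \<open>p\<close> and
  \<open>C\<close>.\<close>

lemma Lp_le_Jseq:
  assumes p: "1 < p" and C: "0 < C"
  obtains M where "0 < M"
    "\<And>f. integrable lborel f \<Longrightarrow> (\<And>x. x \<notin> {-pi..pi} \<Longrightarrow> f x = 0) \<Longrightarrow> GM_bar_with C (fourier_coeff f) \<Longrightarrow>
       Lp_norm_pow p f \<le> ennreal M * Jseq p (fourier_coeff f)"
proof -
  obtain M where M: "0 < M" "\<And>u v. (\<And>n. 0 \<le> u n) \<Longrightarrow> (\<And>n. 0 \<le> v n) \<Longrightarrow>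
       (\<And>n. ennreal (v n) \<le> ennreal 1 * (\<Sum>j. ennreal (kap n j * u j))) \<Longrightarrow>
       wsum p v \<le> ennreal M * wsum p u"
    using hardy_kap[OF p zero_less_one] by blast
  \<comment> \<open>The numeral \<open>num.Bit0 num.One\<close> is 2, the constant in the bound of
    \<open>hat_a\<close> by block means.\<close>
  obtain M2 where M2: "0 < M2" "\<And>u v. (\<And>n. 0 \<le> u n) \<Longrightarrow> (\<And>n. 0 \<le> v n) \<Longrightarrow>
       (\<And>n. ennreal (v n) \<le> ennreal 2 * (\<Sum>j. ennreal (kap n j * u j))) \<Longrightarrow>
       wsum p v \<le> ennreal M2 * wsum p u"
    using hardy_kap[OF p zero_less_numeral, of "num.Bit0 num.One"] by blast
  define c where "c = 3 + 3 * C"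
  define K1 where "K1 = 2 * pi * (15 * c) powr p"
  define K2 where "K2 = 2 powr p * 2 powr \<bar>p - 2\<bar>"
  have K: "0 < K1" "0 < K2" "0 < c" using C by (auto simp: K1_def K2_def c_def)
  show ?thesis
  proof (rule that[of "K1 * (M * (M * (M2 * K2)))"])
    show "0 < K1 * (M * (M * (M2 * K2)))" using K M(1) M2(1) by simp
    fix f :: "real \<Rightarrow> complex"
    assume f: "integrable lborel f" and supp: "\<And>x. x \<notin> {-pi..pi} \<Longrightarrow> f x = 0"
      and GM: "GM_bar_with C (fourier_coeff f)"
    define a where "a = fourier_coeff f"
    define G where "G = gm_bound a"
    define E where "E j = (\<Sum>n. kap j n * G n)" for j
    note bnd = norm_fourier_coeff_le[OF f supp, folded a_def]
    note GM' = GM[folded a_def]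
    have G_nonneg: "0 \<le> G n" for n unfolding G_def by (rule gm_bound_nonneg[OF bnd])
    show "Lp_norm_pow p f \<le> ennreal (K1 * (M * (M * (M2 * K2)))) * Jseq p (fourier_coeff f)"
    proof (cases "Jseq p a = top")
      case True
      thus ?thesis using K M(1) M2(1) by (simp add: a_def ennreal_mult_top)
    next
      case False
      have "wsum p G \<le> ennreal M * wsum p (hat_a a)"
        unfolding G_def using gm_bound_le_suminf[OF bnd] by (intro M hat_a_nonneg gm_bound_nonneg[OF bnd]) auto
      also have "wsum p (hat_a a) \<le> ennreal M2 * wsum p (block_mean a)"
        by (intro M2 hat_a_nonneg block_mean_nonneg hat_a_le_block_mean)
      also have "wsum p (block_mean a) \<le> ennreal K2 * Jseq p a"
        unfolding K2_def by (rule wsum_block_mean_le[OF p])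
      finally have GJ: "wsum p G \<le> ennreal M * (ennreal M2 * (ennreal K2 * Jseq p a))"
        by (simp add: mult_left_mono)
      also have "\<dots> < top"
        using False by (simp add: ennreal_mult_less_top less_top)
      finally have "wsum p G \<noteq> top" by simp
      hence G: "summable G"
        by (rule wsum_finite_imp_summable[OF p G_nonneg])
      have E_nonneg: "0 \<le> E j" for j
        unfolding E_def by (rule suminf_kap_nonneg[OF G_nonneg G])
      have EG: "wsum p E \<le> ennreal M * wsum p G"
      proof (intro M G_nonneg E_nonneg)
        show "ennreal (E n) \<le> ennreal 1 * (\<Sum>j. ennreal (kap n j * G j))" for n
          unfolding E_def using summable_kap[OF G_nonneg G, of n]
          by (subst suminf_ennreal2) (auto intro: mult_nonneg_nonneg kap_nonneg G_nonneg)
      qed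
      \<comment> \<open>The length of the shell times the p-th power of the height
        \<open>2 ^ j\<close> leaves precisely the weight
        \<open>2 powr (j * (p - 1))\<close>.\<close>
      have "2 * pi / 2 ^ j * (15 * (2 ^ j * (c * E j))) powr p = K1 * (2 powr (real j * (p - 1)) * E j powr p)" for j
      proof -
        have "2 powr (real j * (p - 1)) = 2 powr (real j * p) / 2 ^ j"
          by (simp add: right_diff_distrib powr_diff powr_realpow)
        thus ?thesis using K E_nonneg by (simp add: K1_def powr_mult power2_powr)
      qed
      hence u: "(\<Sum>j. ennreal (2 * pi / 2 ^ j * (15 * (2 ^ j * (c * E j))) powr p)) = ennreal K1 * wsum p E"
        using K by (simp add: wsum_def ennreal_mult')
      have "wsum p E < top"
        using order_le_less_trans[OF EG, of top] \<open>wsum p G \<noteq> top\<close> by (simp add: ennreal_mult_less_top less_top)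
      hence fin: "ennreal K1 * wsum p E \<noteq> top"
        by (simp add: ennreal_mult_eq_top_iff)
      have u_nonneg: "0 \<le> 15 * (2 ^ j * (c * E j))" for j
        using K E_nonneg by simp
      obtain W where W: "integrable lborel W" "\<And>x. 0 \<le> W x"
          "\<And>x j. x \<in> shell j \<Longrightarrow> 15 * (2 ^ j * (c * E j)) = W x"
          "(\<integral>\<^sup>+x. ennreal (W x powr p) \<partial>lborel) \<le> ennreal K1 * wsum p E"
        using shell_majorant[where u = "\<lambda>j. 15 * (2 ^ j * (c * E j))", OF p u_nonneg] fin
        unfolding u by blast
      have "AE x in lborel. norm (f x) \<le> W x"
      proof (rule AE_norm_le_majorant[where G = G and c = c])
        show "norm (fourier_coeff f (s * int k)) \<le> c * G n" if "s = 1 \<or> s = - 1" "k \<in> {2 ^ n div 2..<2 ^ n}" for s n k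
          using one_sided_le_gm_bound[OF bnd GM' that(1)] that(2) by (simp add: c_def G_def a_def)
        have "C * G n \<le> c * G n" for n
          using C G_nonneg[of n] by (intro mult_right_mono) (auto simp: c_def)
        thus "(\<Sum>k\<in>{2 ^ n div 2..<2 ^ n}. norm (fourier_coeff f (s * int k) - fourier_coeff f (s * int (Suc k)))) \<le> c * G n"
          if "s = 1 \<or> s = - 1" for s n
          using one_sided_variation_le[OF bnd GM' that, of n] unfolding G_def a_def by (rule order_trans[rotated])
        show "15 * (2 ^ j * (c * (\<Sum>n. kap j n * G n))) \<le> W x" if "x \<in> shell j" for x j
          using W(3)[OF that] by (simp add: E_def)
      qed (use f supp K G G_nonneg W in auto)
      hence "Lp_norm_pow p f \<le> (\<integral>\<^sup>+x. ennreal (W x powr p) \<partial>lborel)"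
        unfolding Lp_norm_pow_def
      proof (intro nn_integral_mono_AE, eventually_elim)
        case (elim x)
        hence "norm (f x) powr p \<le> W x powr p" using p by (intro powr_mono2) auto
        thus ?case by (auto simp: indicator_def intro: ennreal_leI)
      qed
      also have "\<dots> \<le> ennreal K1 * wsum p E" by (rule W)
      also have "wsum p E \<le> ennreal M * (ennreal M * (ennreal M2 * (ennreal K2 * Jseq p a)))"
        using EG GJ by (meson mult_left_mono order_trans zero_le)
      finally have "Lp_norm_pow p f \<le> ennreal K1 * (ennreal M * (ennreal M * (ennreal M2 * (ennreal K2 * Jseq p a))))"
        by (simp add: mult_left_mono)
      thus ?thesis
        using K M(1) M2(1) by (simp add: ennreal_mult mult.assoc a_def)
    qed
  qed
qed

text \<open>Both functionals are p-th powers, so \<open>c1\<close> and \<open>c2\<close> are p-th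
  powers of the constants for the norms. Stated in \<open>ennreal\<close> with positive constants,
  the bounds include simultaneous finiteness.\<close>

theorem theorem2:
  fixes p C :: real
  assumes "1 < p" and "C > 0"
  shows "\<exists>c1 c2. 0 < c1 \<and> c1 \<le> c2 \<and>
     (\<forall>f :: real \<Rightarrow> complex.
        set_integrable lborel {-pi..pi} f \<and> GM_bar_with C (fourier_coeff f) \<longrightarrow>
          ennreal c1 * Jp_pow p f \<le> Lp_norm_pow p f \<and>
          Lp_norm_pow p f \<le> ennreal c2 * Jp_pow p f)"
proof -
  obtain M1 where M1: "0 < M1"
    "\<And>f. integrable lborel f \<Longrightarrow> (\<And>x. x \<notin> {-pi..pi} \<Longrightarrow> f x = 0) \<Longrightarrow> GM_bar_with C (fourier_coeff f) \<Longrightarrow>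
       Jseq p (fourier_coeff f) \<le> ennreal M1 * Lp_norm_pow p f"
    using Jseq_le_Lp[OF assms] by blast
  obtain M2 where M2: "0 < M2"
    "\<And>f. integrable lborel f \<Longrightarrow> (\<And>x. x \<notin> {-pi..pi} \<Longrightarrow> f x = 0) \<Longrightarrow> GM_bar_with C (fourier_coeff f) \<Longrightarrow>
       Lp_norm_pow p f \<le> ennreal M2 * Jseq p (fourier_coeff f)"
    using Lp_le_Jseq[OF assms] by blast
  \<comment> \<open>The maximum with \<open>1 / M1\<close> only secures
    \<open>c1 \<le> c2\<close>.\<close>
  have "ennreal (1 / M1) * Jp_pow p f \<le> Lp_norm_pow p f \<and> Lp_norm_pow p f \<le> ennreal (max M2 (1 / M1)) * Jp_pow p f"
    if f: "set_integrable lborel {-pi..pi} f" and GM: "GM_bar_with C (fourier_coeff f)" for f :: "real \<Rightarrow> complex"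
  proof -
    \<comment> \<open>\<open>f\<close> is given as integrable on the interval only; cutting it off
      there changes neither its coefficients nor its norm.\<close>
    define f' where "f' x = indicator {-pi..pi} x *\<^sub>R f x" for x
    have int: "integrable lborel f'"
      using f by (simp add: set_integrable_def f'_def[abs_def])
    have supp: "f' x = 0" if "x \<notin> {-pi..pi}" for x
      using that by (simp add: f'_def)
    have coeff: "fourier_coeff f' = fourier_coeff f"
      unfolding fourier_coeff_def set_lebesgue_integral_def f'_def
      by (intro ext arg_cong2[where f = "(*)"] refl Bochner_Integration.integral_cong) (auto simp: indicator_def)
    have Lp: "Lp_norm_pow p f' = Lp_norm_pow p f"
      unfolding Lp_norm_pow_def f'_def by (intro nn_integral_cong) (auto simp: indicator_def)
    have J: "Jp_pow p f = Jseq p (fourier_coeff f)"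
      by (simp add: Jp_pow_def Jseq_def)
    have 1: "Jp_pow p f \<le> ennreal M1 * Lp_norm_pow p f"
      using M1(2)[OF int supp] GM by (simp add: coeff Lp J)
    have 2: "Lp_norm_pow p f \<le> ennreal M2 * Jp_pow p f"
      using M2(2)[OF int supp] GM by (simp add: coeff Lp J)
    have "ennreal (1 / M1) * Jp_pow p f \<le> ennreal (1 / M1) * (ennreal M1 * Lp_norm_pow p f)"
      by (intro mult_left_mono 1) auto
    also have "\<dots> = Lp_norm_pow p f"
      using M1(1) by (simp add: mult.assoc[symmetric] ennreal_mult'[symmetric])
    finally have "ennreal (1 / M1) * Jp_pow p f \<le> Lp_norm_pow p f" .
    moreover have "ennreal M2 * Jp_pow p f \<le> ennreal (max M2 (1 / M1)) * Jp_pow p f"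
      by (intro mult_right_mono ennreal_leI) auto
    ultimately show ?thesis using 2 by (auto intro: order_trans)
  qed
  thus ?thesis
    using M1(1) by (intro exI[of _ "1 / M1"] exI[of _ "max M2 (1 / M1)"]) auto
qed

end
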